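(* For a positive integer $h$, let $G_h$ be the simple graph whose vertex set consists of a set $S$ of $h$ hub vertices together with four further vertices $a,b,c,d$, and whose edges are: all $4h$ edges joining a vertex of $S$ to one of $a,b,c,d$, together with the two edges $A=ab$ and $B=cd$ (there are no edges inside $S$ and no other edges). Let the edge weights be i.i.d. with an atomless law, let $T$ be the almost surely unique minimum spanning tree, and write $p_A=\mathbf{P}(A\in T)$, $p_B=\mathbf{P}(B\in T)$, $p_{AB}=\mathbf{P}(A\in T,\ B\in T)$. For $h=2$, $$p_A=p_B=\frac12,\qquad p_{AB}=\frac{1186}{4725},\qquad \frac{p_{AB}}{p_Ap_B}=\frac{4744}{4725}.$$ For $h=3$, $$p_A=p_B=\frac{1123}{2730},\qquad p_{AB}=\frac{71479}{420420},\qquad \frac{p_{AB}}{p_Ap_B}=\frac{13938405}{13872419}=1.004756\ldots,$$ and in particular this ratio is larger than $78100/77841$. Moreover, over the range $1\le h\le 9$, the ratio $p_{AB}/(p_Ap_B)$ is maximized at $h=3$, and it is below $1$ for $h=7,8,9$.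
   Context: Since the weights are i.i.d. with an atomless law, all strict orders of the edges are equally likely, and the minimum spanning tree is determined by the order (Kruskal's algorithm). *)

theory Defs
  imports "HOL-Probability.Probability"
begin

text \<open>
  A finite simple graph is given by a vertex set \<open>V\<close> and a set \<open>E\<close> of two-element subsets of
  \<open>V\<close>. The spanning trees of the AFP entry \<open>Graph_Theory\<close> are not used, because
  forests there exclude only directed cycles.
\<close>

definition connected_graph :: "'v set \<Rightarrow> 'v set set \<Rightarrow> bool" where
  "connected_graph V E \<longleftrightarrow> V \<noteq> {} \<and> (\<forall>u\<in>V. \<forall>v\<in>V. (u, v) \<in> {(x, y). {x, y} \<in> E}\<^sup>*)"

text \<open>The vertices of a cycle are listed in cyclic order, without repeating the first one.\<close>

definition is_cycle :: "'v set set \<Rightarrow> 'v list \<Rightarrow> bool" where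
  "is_cycle E vs \<longleftrightarrow> 3 \<le> length vs \<and> distinct vs \<and>
     (\<forall>i < length vs. {vs ! i, vs ! (Suc i mod length vs)} \<in> E)"

definition is_tree :: "'v set \<Rightarrow> 'v set set \<Rightarrow> bool" where
  "is_tree V E \<longleftrightarrow> connected_graph V E \<and> (\<nexists>vs. is_cycle E vs)"

definition spanning_tree :: "'v set \<Rightarrow> 'v set set \<Rightarrow> 'v set set \<Rightarrow> bool" where
  "spanning_tree V E F \<longleftrightarrow> F \<subseteq> E \<and> is_tree V F"

definition min_spanning_tree ::
    "'v set \<Rightarrow> 'v set set \<Rightarrow> ('v set \<Rightarrow> real) \<Rightarrow> 'v set set \<Rightarrow> bool" where
  "min_spanning_tree V E w F \<longleftrightarrow> is_arg_min (\<lambda>F'. \<Sum>e\<in>F'. w e) (spanning_tree V E) F"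

text \<open>Only meaningful when the minimum spanning tree is unique.\<close>

definition the_mst :: "'v set \<Rightarrow> 'v set set \<Rightarrow> ('v set \<Rightarrow> real) \<Rightarrow> 'v set set" where
  "the_mst V E w = (THE F. min_spanning_tree V E w F)"

datatype vertex = Hub nat | Va | Vb | Vc | Vd

definition hubs :: "nat \<Rightarrow> vertex set" where
  "hubs h = Hub ` {..<h}"

definition edge_A :: "vertex set" where
  "edge_A = {Va, Vb}"

definition edge_B :: "vertex set" where
  "edge_B = {Vc, Vd}"

definition G_verts :: "nat \<Rightarrow> vertex set" where
  "G_verts h = hubs h \<union> {Va, Vb, Vc, Vd}"

definition G_edges :: "nat \<Rightarrow> vertex set set" where
  "G_edges h = {{s, x} | s x. s \<in> hubs h \<and> x \<in> {Va, Vb, Vc, Vd}} \<union> {edge_A, edge_B}"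

text \<open>
  For a law on the real line, having no atoms means giving mass zero to every single point.
\<close>

locale iid_atomless_weights = prob_space M
  for M :: "'w measure" +
  fixes E :: "'e set" and W :: "'e \<Rightarrow> 'w \<Rightarrow> real" and law :: "real measure"
  assumes indep_weights: "indep_vars (\<lambda>_. borel) W E"
    and weight_law: "\<And>e. e \<in> E \<Longrightarrow> distr M borel (W e) = law"
    and atomless: "\<And>x. emeasure law {x} = 0"

definition random_mst :: "nat \<Rightarrow> (vertex set \<Rightarrow> 'w \<Rightarrow> real) \<Rightarrow> 'w \<Rightarrow> vertex set set" where
  "random_mst h W \<omega> = the_mst (G_verts h) (G_edges h) (\<lambda>e. W e \<omega>)"

definition p_A :: "nat \<Rightarrow> 'w measure \<Rightarrow> (vertex set \<Rightarrow> 'w \<Rightarrow> real) \<Rightarrow> real" where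
  "p_A h M W = measure M {\<omega> \<in> space M. edge_A \<in> random_mst h W \<omega>}"

definition p_B :: "nat \<Rightarrow> 'w measure \<Rightarrow> (vertex set \<Rightarrow> 'w \<Rightarrow> real) \<Rightarrow> real" where
  "p_B h M W = measure M {\<omega> \<in> space M. edge_B \<in> random_mst h W \<omega>}"

definition p_AB :: "nat \<Rightarrow> 'w measure \<Rightarrow> (vertex set \<Rightarrow> 'w \<Rightarrow> real) \<Rightarrow> real" where
  "p_AB h M W =
     measure M {\<omega> \<in> space M. edge_A \<in> random_mst h W \<omega> \<and> edge_B \<in> random_mst h W \<omega>}"

definition mst_ratio :: "nat \<Rightarrow> 'w measure \<Rightarrow> (vertex set \<Rightarrow> 'w \<Rightarrow> real) \<Rightarrow> real" where
  "mst_ratio h M W = p_AB h M W / (p_A h M W * p_B h M W)"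

end

(*
  An edge belongs to the minimum spanning tree iff its endpoints are not connected by lighter edges.
  In G_h this is a condition on cuts: if the lighter of the two edges A, B is ab, with weight s, and
  the heavier is cd, with weight t, then ab is in T iff, for one of the four sets P of terminals with
  a in P and b outside P, no hub has edges lighter than s both into and out of P; for cd the light edge
  ab leaves two such sets. Given s and t the hubs are independent, so inclusion and exclusion
  over the cuts turns each probability into a combination of integrals of h-th powers. Since the law
  has no atoms, its quantile function is strictly increasing and maps the uniform law to it, so one may
  take uniform weights; the integrals over 0 < u < v < 1 are then integrals of polynomials, which
  are expanded by the multinomial theorem and evaluated by the beta integral.
*)
theory Submission
  imports Defs
begin

section \<open>Minimum spanning trees for distinct weights\<close>

text \<open>The edge criterion rests on exchanging one tree edge, so trees are handled through
  connectivity and bridges rather than through lists of vertices. A hub respects a family of cuts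
  exactly when its light edges all end in one block of their common refinement. Hence many terms of
  the inclusion-exclusion coincide: the fifteen for the lighter edge need only four polynomials, and
  the joint event, once eight pairs of cuts have collapsed to four, needs three. With two more for
  the heavier edge there are nine polynomials in \<open>u\<close> and \<open>v\<close>, the values
  of the distribution function at the two special weights. All have the shape \<open>(1 - v)^e * (1
  + x * u^2 + y * u^3 + z * u^p * v^q * (1 - v)^r)\<close>, so one expansion serves them all. The
  comparison over \<open>1 \<le> h \<le> 9\<close> is settled by exact rational evaluation for each
  \<open>h\<close>.\<close>

definition conn :: "'v set set \<Rightarrow> 'v \<Rightarrow> 'v \<Rightarrow> bool" where
  "conn F u v \<longleftrightarrow> (u, v) \<in> {(x, y). {x, y} \<in> F}\<^sup>*"

lemma conn_refl [simp]: "conn F u u"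
  by (simp add: conn_def)

lemma conn_trans: "conn F u v \<Longrightarrow> conn F v w \<Longrightarrow> conn F u w"
  by (auto simp: conn_def)

lemma conn_edge: "{u, v} \<in> F \<Longrightarrow> conn F u v"
  by (auto simp: conn_def)

lemma conn_mono: "conn F u v \<Longrightarrow> F \<subseteq> F' \<Longrightarrow> conn F' u v"
  unfolding conn_def by (rule rtrancl_mono [THEN subsetD]) auto

lemma conn_sym: "conn F u v \<Longrightarrow> conn F v u"
proof -
  have "sym {(x, y). {x, y} \<in> F}"
    by (auto simp: sym_def insert_commute)
  then show "conn F u v \<Longrightarrow> conn F v u"
    unfolding conn_def by (meson sym_rtrancl symD)
qed

lemma conn_step: "conn F u v \<Longrightarrow> {v, w} \<in> F \<Longrightarrow> conn F u w"
  by (meson conn_edge conn_trans)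

lemma conn_induct [consumes 1, case_names refl step]:
  assumes "conn F u v" "P u" "\<And>v w. conn F u v \<Longrightarrow> {v, w} \<in> F \<Longrightarrow> P v \<Longrightarrow> P w"
  shows "P v"
  using assms(1) unfolding conn_def
  by (induction rule: rtrancl_induct) (auto simp: assms(2) intro: assms(3) [unfolded conn_def])

text \<open>A walk can be shortened until it uses the new edge at most once; the last two disjuncts
  record the direction of that use.\<close>

lemma conn_insertD:
  assumes "conn (insert {x, y} P) u v"
  shows "conn P u v \<or> (conn P u x \<and> conn P y v) \<or> (conn P u y \<and> conn P x v)"
  using assms
proof (induction rule: conn_induct)
  case (step v w)
  show ?case
  proof (cases "{v, w} \<in> P")
    case True
    then show ?thesis
      using step.IH by (meson conn_step)
  next
    case False
    then have "v = x \<and> w = y \<or> v = y \<and> w = x"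
      using step.hyps by (auto simp: doubleton_eq_iff)
    then show ?thesis
      using step.IH by (metis conn_refl conn_sym conn_trans)
  qed
qed auto

lemma conn_replace:
  assumes "conn (insert {x, y} P) u v" "P \<subseteq> Q" "conn Q x y"
  shows "conn Q u v"
  using conn_insertD [OF assms(1)] assms(2,3) by (meson conn_mono conn_sym conn_trans)

text \<open>The list runs backwards, from \<open>v\<close> to \<open>u\<close>, so that an induction
  step conses at the front; if the new vertex already occurs, everything before it is
  dropped.\<close>

lemma conn_imp_simple_path:
  assumes "conn F u v"
  shows "\<exists>vs. vs \<noteq> [] \<and> distinct vs \<and> hd vs = v \<and> last vs = u \<and> successively (\<lambda>x y. {x, y} \<in> F) vs"
  using assms
proof (induction rule: conn_induct)
  case refl
  show ?case by (rule exI [of _ "[u]"]) auto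
next
  case (step v w)
  then obtain vs where vs: "vs \<noteq> []" "distinct vs" "hd vs = v" "last vs = u"
    "successively (\<lambda>x y. {x, y} \<in> F) vs"
    by blast
  show ?case
  proof (cases "w \<in> set vs")
    case False
    then show ?thesis
      using vs step.hyps
      by (intro exI [of _ "w # vs"]) (auto simp: successively_Cons insert_commute)
  next
    case True
    then obtain as bs where "vs = as @ w # bs"
      by (meson split_list)
    then show ?thesis
      using vs by (intro exI [of _ "w # bs"]) (auto simp: successively_append_iff)
  qed
qed

text \<open>For edge sets without loops this is acyclicity, stated through connectivity alone, which
  suits the exchange of edges better than lists of vertices.\<close>

definition all_bridges :: "'v set set \<Rightarrow> bool" where
  "all_bridges F \<longleftrightarrow> (\<forall>x y. {x, y} \<in> F \<longrightarrow> \<not> conn (F - {{x, y}}) x y)"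

lemma no_cycle_imp_all_bridges:
  assumes F: "\<forall>e\<in>F. card e = 2" and no_cycle: "\<nexists>vs. is_cycle F vs"
  shows "all_bridges F"
  unfolding all_bridges_def
proof (intro allI impI notI)
  fix x y assume xy: "{x, y} \<in> F" and c: "conn (F - {{x, y}}) x y"
  obtain vs where vs: "vs \<noteq> []" "distinct vs" "hd vs = y" "last vs = x"
    "successively (\<lambda>u v. {u, v} \<in> F - {{x, y}}) vs"
    using conn_imp_simple_path [OF c] by blast
  have "card {x, y} = 2"
    using F xy by blast
  then have "x \<noteq> y"
    by auto
  \<comment> \<open>A path with only two vertices would use the deleted edge \<open>{x, y}\<close>
    itself.\<close>
  have "3 \<le> length vs"
  proof (rule ccontr)
    assume "\<not> 3 \<le> length vs"
    then have "length vs = 0 \<or> length vs = 1 \<or> length vs = 2"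
      by linarith
    then consider p where "vs = [p]" | p q where "vs = [p, q]"
      using vs(1) by (auto simp: length_Suc_conv numeral_2_eq_2)
    then show False
      using vs(3-5) \<open>x \<noteq> y\<close> by cases (simp_all add: insert_commute)
  qed
  moreover have "{vs ! i, vs ! (Suc i mod length vs)} \<in> F" if "i < length vs" for i
  proof (cases "Suc i < length vs")
    case True
    then show ?thesis
      using vs(5) by (auto simp: successively_conv_nth)
  next
    case False
    \<comment> \<open>At the last index the successor wraps around to 0; the edge needed there is
      \<open>{x, y}\<close>, which closes the path.\<close>
    then have "Suc i = length vs"
      using that by simp
    moreover from this have "length vs - 1 = i"
      by simp
    ultimately have "vs ! i = x" "Suc i mod length vs = 0"
      using vs(1,4) by (simp_all add: last_conv_nth)
    then show ?thesis
      using vs(1,3) xy by (simp add: hd_conv_nth)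
  qed
  ultimately show False
    using no_cycle vs(2) by (auto simp: is_cycle_def)
qed

text \<open>The rest of a cycle, followed from \<open>vs ! 1\<close> to the last vertex and on to
  \<open>vs ! 0\<close>, bypasses the edge between the first two vertices.\<close>

lemma all_bridges_imp_no_cycle:
  assumes "all_bridges F"
  shows "\<not> is_cycle F vs"
proof
  assume "is_cycle F vs"
  then have n: "3 \<le> length vs" and d: "distinct vs"
    and e: "\<And>i. i < length vs \<Longrightarrow> {vs ! i, vs ! (Suc i mod length vs)} \<in> F"
    by (auto simp: is_cycle_def)
  have "vs \<noteq> []"
    using n by auto
  let ?e = "{vs ! 0, vs ! 1}"
  have conn: "Suc k < length vs \<Longrightarrow> conn (F - {?e}) (vs ! 1) (vs ! Suc k)" for k
  proof (induction k)
    case (Suc k)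
    have "{vs ! Suc k, vs ! Suc (Suc k)} \<in> F"
      using e [of "Suc k"] Suc.prems by simp
    moreover have "{vs ! Suc k, vs ! Suc (Suc k)} \<noteq> ?e"
      using d Suc.prems n \<open>vs \<noteq> []\<close> by (auto simp: doubleton_eq_iff nth_eq_iff_index_eq)
    ultimately show ?case
      using Suc by (auto intro: conn_step)
  qed simp
  obtain m where m: "length vs = Suc (Suc (Suc m))"
    using n by (metis Suc_le_D Suc_le_mono eval_nat_numeral(3) numeral_2_eq_2)
  have "{vs ! Suc (Suc m), vs ! 0} \<in> F - {?e}"
    using e [of "Suc (Suc m)"] m d by (auto simp: doubleton_eq_iff nth_eq_iff_index_eq)
  then have "conn (F - {?e}) (vs ! 1) (vs ! 0)"
    using conn [of "Suc m"] m by (auto intro: conn_step)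
  then have "conn (F - {?e}) (vs ! 0) (vs ! 1)"
    by (rule conn_sym)
  moreover have "?e \<in> F"
    using e [of 0] m by simp
  ultimately show False
    using assms by (auto simp: all_bridges_def)
qed

lemma is_tree_iff:
  assumes "\<forall>e\<in>F. card e = 2" "V \<noteq> {}"
  shows "is_tree V F \<longleftrightarrow> (\<forall>u\<in>V. \<forall>v\<in>V. conn F u v) \<and> all_bridges F"
proof -
  have "(\<nexists>vs. is_cycle F vs) \<longleftrightarrow> all_bridges F"
    using assms(1) no_cycle_imp_all_bridges all_bridges_imp_no_cycle by metis
  moreover have "connected_graph V F \<longleftrightarrow> (\<forall>u\<in>V. \<forall>v\<in>V. conn F u v)"
    using assms(2) by (simp only: connected_graph_def conn_def simp_thms)
  ultimately show ?thesis
    by (simp only: is_tree_def)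
qed

text \<open>If another edge \<open>{p, q}\<close> ceased to be a bridge, its detour would have to
  use \<open>{u, v}\<close>, since \<open>{p, q}\<close> is a bridge of \<open>F\<close>. The
  remainder of the detour together with \<open>{p, q}\<close> would then join \<open>u\<close> to
  \<open>v\<close> in \<open>F - {{x, y}}\<close>.\<close>

lemma all_bridges_exchange:
  assumes F: "all_bridges F" and e: "{x, y} \<in> F" and f: "\<not> conn (F - {{x, y}}) u v"
  shows "all_bridges (insert {u, v} (F - {{x, y}}))"
  unfolding all_bridges_def
proof (intro allI impI notI)
  let ?P = "F - {{x, y}}"
  fix p q assume pq: "{p, q} \<in> insert {u, v} ?P"
    and c: "conn (insert {u, v} ?P - {{p, q}}) p q"
  have uv: "{u, v} \<notin> ?P"
    using f by (metis conn_edge)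
  show False
  proof (cases "{p, q} = {u, v}")
    case True
    then have "conn ?P p q"
      using c uv by simp
    then show False
      using True f by (metis conn_sym doubleton_eq_iff)
  next
    case False
    then have *: "{p, q} \<in> F" "{p, q} \<in> ?P"
      using pq by simp_all
    have "insert {u, v} ?P - {{p, q}} = insert {u, v} (?P - {{p, q}})"
      using False by (simp add: insert_Diff_if)
    then have "conn (insert {u, v} (?P - {{p, q}})) p q"
      using c by simp
    moreover have "\<not> conn (F - {{p, q}}) p q"
      using F * by (simp add: all_bridges_def)
    then have "\<not> conn (?P - {{p, q}}) p q"
      by (meson conn_mono Diff_mono Diff_subset subset_refl)
    ultimately have "(conn (?P - {{p, q}}) p u \<and> conn (?P - {{p, q}}) v q) \<or>
        (conn (?P - {{p, q}}) p v \<and> conn (?P - {{p, q}}) u q)"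
      using conn_insertD [of u v "?P - {{p, q}}" p q] by argo
    then have "(conn ?P p u \<and> conn ?P v q) \<or> (conn ?P p v \<and> conn ?P u q)"
      by (meson Diff_subset conn_mono)
    moreover have "conn ?P p q"
      using *(2) by (rule conn_edge)
    ultimately show False
      using f by (meson conn_sym conn_trans)
  qed
qed

section \<open>Membership criterion and uniqueness for minimum spanning trees\<close>

locale weighted_graph =
  fixes V :: "'v set" and E :: "'v set set" and w :: "'v set \<Rightarrow> real"
  assumes finite_edges: "finite E"
    and edges_card: "\<And>e. e \<in> E \<Longrightarrow> card e = 2"
    and edges_V: "\<And>e. e \<in> E \<Longrightarrow> e \<subseteq> V"
    and V_nonempty: "V \<noteq> {}"
    and connected: "\<And>u v. u \<in> V \<Longrightarrow> v \<in> V \<Longrightarrow> conn E u v"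
    and distinct_weights: "inj_on w E"
begin

lemma spanning_tree_iff:
  "spanning_tree V E F \<longleftrightarrow> F \<subseteq> E \<and> (\<forall>u\<in>V. \<forall>v\<in>V. conn F u v) \<and> all_bridges F"
  using is_tree_iff [of F V] edges_card V_nonempty unfolding spanning_tree_def by blast

text \<open>In a minimal edge set that connects all vertices, every edge is a bridge, since any
  other edge could be dropped.\<close>

lemma ex_spanning_tree: "\<exists>F. spanning_tree V E F"
proof -
  let ?S = "{F. F \<subseteq> E \<and> (\<forall>u\<in>V. \<forall>v\<in>V. conn F u v)}"
  have "finite ?S"
    using finite_edges by (rule_tac finite_subset [of _ "Pow E"]) auto
  moreover have "E \<in> ?S"
    using connected by simp
  ultimately have "\<exists>F\<in>?S. F \<subseteq> E \<and> (\<forall>F'\<in>?S. F' \<subseteq> F \<longrightarrow> F = F')"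
    by (rule finite_has_minimal2)
  then obtain F where F: "F \<in> ?S" "\<forall>F'\<in>?S. F' \<subseteq> F \<longrightarrow> F = F'"
    by (elim bexE conjE)
  have "all_bridges F"
    unfolding all_bridges_def
  proof (intro allI impI notI)
    fix x y assume xy: "{x, y} \<in> F" "conn (F - {{x, y}}) x y"
    have "insert {x, y} (F - {{x, y}}) = F"
      using xy(1) by (rule insert_Diff)
    then have "conn (F - {{x, y}}) u v" if "u \<in> V" "v \<in> V" for u v
      using conn_replace [of x y "F - {{x, y}}" u v "F - {{x, y}}"] xy(2) F(1) that by simp
    then have "F - {{x, y}} \<in> ?S"
      using F(1) by (simp add: Diff_subset [THEN subset_trans])
    then have "F = F - {{x, y}}"
      using F(2) Diff_subset by (metis (no_types, lifting))
    then show False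
      using xy(1) by (metis Diff_iff singletonI)
  qed
  then show ?thesis
    using F(1) spanning_tree_iff by (metis (mono_tags, lifting) mem_Collect_eq)
qed

definition lighter :: "'v set \<Rightarrow> 'v set set" where
  "lighter e = {f \<in> E. w f < w e}"

text \<open>Deleting \<open>{x, y}\<close> splits the tree into two components;
  \<open>{u, v}\<close> runs between them, so \<open>x\<close> and \<open>y\<close> are joined again
  through it.\<close>

lemma exchange:
  assumes F: "spanning_tree V E F" and e: "{x, y} \<in> F" and f: "{u, v} \<in> E"
    and sep: "\<not> conn (F - {{x, y}}) u v"
  shows "spanning_tree V E (insert {u, v} (F - {{x, y}}))"
    and "sum w (insert {u, v} (F - {{x, y}})) = sum w F - w {x, y} + w {u, v}"
proof -
  let ?P = "F - {{x, y}}" and ?F = "insert {u, v} (F - {{x, y}})"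
  have FE: "F \<subseteq> E" and con: "\<And>p q. p \<in> V \<Longrightarrow> q \<in> V \<Longrightarrow> conn F p q" and br: "all_bridges F"
    using F by (auto simp: spanning_tree_iff)
  have ins: "insert {x, y} ?P = F"
    using e by (rule insert_Diff)
  have "u \<in> V" "v \<in> V"
    using edges_V f by auto
  then have "conn (insert {x, y} ?P) u v"
    using con ins by simp
  then have "(conn ?P u x \<and> conn ?P y v) \<or> (conn ?P u y \<and> conn ?P x v)"
    using conn_insertD sep by metis
  then have "conn ?F x y"
    by (meson conn_edge conn_mono conn_sym conn_trans insertI1 subset_insertI)
  then have "conn ?F p q" if "p \<in> V" "q \<in> V" for p q
    using conn_replace [of x y ?P p q ?F] con [OF that] ins by (simp add: subset_insertI)
  then show "spanning_tree V E ?F"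
    using all_bridges_exchange [OF br e sep] FE f
    by (simp add: spanning_tree_iff Diff_subset [THEN subset_trans])
  have "{u, v} \<notin> ?P"
    using sep by (metis conn_edge)
  moreover have "finite F"
    using FE finite_edges finite_subset by blast
  ultimately show "sum w ?F = sum w F - w {x, y} + w {u, v}"
    using e by (simp add: sum_diff1)
qed

lemma mst_le:
  assumes "min_spanning_tree V E w F" "spanning_tree V E F'"
  shows "sum w F \<le> sum w F'"
  using assms unfolding min_spanning_tree_def is_arg_min_def by (meson not_le)

lemma mst_spanning_tree: "min_spanning_tree V E w F \<Longrightarrow> spanning_tree V E F"
  by (simp add: min_spanning_tree_def is_arg_min_def)

lemma ex_separating_edge:
  assumes "conn L u v" "\<not> conn P u v"
  shows "\<exists>p q. {p, q} \<in> L \<and> \<not> conn P p q"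
proof (rule ccontr)
  assume *: "\<nexists>p q. {p, q} \<in> L \<and> \<not> conn P p q"
  have "conn P u v"
    using assms(1) by (induction rule: conn_induct) (use * in \<open>auto intro: conn_trans\<close>)
  then show False
    using assms(2) by simp
qed

text \<open>Both directions exchange edges. If lighter edges join \<open>x\<close> to
  \<open>y\<close>, one of them crosses the split left by deleting \<open>{x, y}\<close> and would
  be a cheaper replacement. If they do not, and \<open>{x, y}\<close> were missing, the tree path
  from \<open>x\<close> to \<open>y\<close> would contain a heavier edge that \<open>{x, y}\<close>
  could replace.\<close>

lemma mem_mst_iff:
  assumes mst: "min_spanning_tree V E w F" and e: "{x, y} \<in> E"
  shows "{x, y} \<in> F \<longleftrightarrow> \<not> conn (lighter {x, y}) x y"
proof -
  have st: "spanning_tree V E F"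
    by (rule mst_spanning_tree [OF mst])
  then have FE: "F \<subseteq> E" and con: "\<And>p q. p \<in> V \<Longrightarrow> q \<in> V \<Longrightarrow> conn F p q" and br: "all_bridges F"
    by (auto simp: spanning_tree_iff)
  show ?thesis
  proof
    assume xy: "{x, y} \<in> F"
    show "\<not> conn (lighter {x, y}) x y"
    proof
      assume "conn (lighter {x, y}) x y"
      moreover have "\<not> conn (F - {{x, y}}) x y"
        using br xy by (simp add: all_bridges_def)
      ultimately have "\<exists>p q. {p, q} \<in> lighter {x, y} \<and> \<not> conn (F - {{x, y}}) p q"
        by (rule ex_separating_edge)
      then obtain p q where pq: "{p, q} \<in> lighter {x, y}" "\<not> conn (F - {{x, y}}) p q"
        by (elim exE conjE)
      then have pqE: "{p, q} \<in> E" and less: "w {p, q} < w {x, y}"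
        by (simp_all add: lighter_def)
      show False
        using exchange(2) [OF st xy pqE pq(2)] mst_le [OF mst exchange(1) [OF st xy pqE pq(2)]] less
        by linarith
    qed
  next
    assume nc: "\<not> conn (lighter {x, y}) x y"
    show "{x, y} \<in> F"
    proof (rule ccontr)
      assume notin: "{x, y} \<notin> F"
      \<comment> \<open>A minimal member of this family plays the part of the tree path from
        \<open>x\<close> to \<open>y\<close>: deleting any of its edges separates \<open>x\<close>
        from \<open>y\<close>.\<close>
      let ?S = "{P. P \<subseteq> F \<and> conn P x y}"
      have "x \<in> V" "y \<in> V"
        using e edges_V by auto
      then have mem: "F \<in> ?S"
        using con by simp
      have "finite ?S"
        using finite_subset [OF FE finite_edges] by (rule_tac finite_subset [of _ "Pow F"]) auto
      from this mem have "\<exists>P\<in>?S. P \<subseteq> F \<and> (\<forall>P'\<in>?S. P' \<subseteq> P \<longrightarrow> P = P')"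
        by (rule finite_has_minimal2)
      then obtain P where P: "P \<in> ?S" "\<forall>P'\<in>?S. P' \<subseteq> P \<longrightarrow> P = P'"
        by (elim bexE conjE)
      have "\<not> P \<subseteq> lighter {x, y}"
        using P(1) nc by (metis (mono_tags, lifting) conn_mono mem_Collect_eq)
      then obtain f where f: "f \<in> P" "f \<notin> lighter {x, y}"
        by (metis subsetI)
      have PF: "P \<subseteq> F"
        using P(1) by simp
      have fF: "f \<in> F" "f \<in> E"
        using PF FE f(1) by (simp_all add: subset_iff)
      then obtain p q where pq: "f = {p, q}"
        using edges_card by (meson card_2_iff)
      \<comment> \<open>\<open>f\<close> lies in \<open>F\<close> and \<open>{x, y}\<close> does
        not, so they are different edges and injectivity of \<open>w\<close> makes \<open>f\<close>
        strictly heavier.\<close>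
      have "w f \<noteq> w {x, y}"
        using distinct_weights fF e notin by (metis inj_onD)
      then have less: "w {x, y} < w {p, q}"
        using f fF pq by (simp add: lighter_def)
      have ins: "insert {p, q} (P - {{p, q}}) = P"
        using f(1) pq by (simp add: insert_absorb)
      have "\<not> conn (P - {{p, q}}) x y"
      proof
        assume "conn (P - {{p, q}}) x y"
        then have "P - {{p, q}} \<in> ?S"
          using P(1) by (simp add: Diff_subset [THEN subset_trans])
        then have "P = P - {{p, q}}"
          using P(2) Diff_subset by (metis (no_types, lifting))
        then show False
          using f(1) pq by (metis Diff_iff singletonI)
      qed
      moreover have "conn (insert {p, q} (P - {{p, q}})) x y"
        using P(1) unfolding ins by simp
      ultimately have "(conn (P - {{p, q}}) x p \<and> conn (P - {{p, q}}) q y) \<or>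
          (conn (P - {{p, q}}) x q \<and> conn (P - {{p, q}}) p y)"
        using conn_insertD by metis
      moreover have "P - {{p, q}} \<subseteq> F - {{p, q}}"
        using PF by (rule Diff_mono) simp
      ultimately have *: "(conn (F - {{p, q}}) x p \<and> conn (F - {{p, q}}) q y) \<or>
          (conn (F - {{p, q}}) x q \<and> conn (F - {{p, q}}) p y)"
        by (meson conn_mono)
      have "\<not> conn (F - {{p, q}}) p q"
        using br fF pq by (simp add: all_bridges_def)
      then have sep: "\<not> conn (F - {{p, q}}) x y"
        using * by (meson conn_sym conn_trans)
      have pqF: "{p, q} \<in> F"
        using fF(1) pq by simp
      show False
        using exchange(2) [OF st pqF e sep] mst_le [OF mst exchange(1) [OF st pqF e sep]] less
        by linarith
    qed
  qed
qed

text \<open>Uniqueness holds because the criterion for membership does not mention the tree.\<close>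

lemma ex1_mst: "\<exists>!F. min_spanning_tree V E w F"
proof -
  have "finite {F. spanning_tree V E F}"
    using finite_edges by (auto simp: spanning_tree_def intro: finite_subset [of _ "Pow E"])
  moreover have "{F. spanning_tree V E F} \<noteq> {}"
    using ex_spanning_tree by auto
  ultimately obtain F where "is_arg_min (sum w) (\<lambda>F. F \<in> {F. spanning_tree V E F}) F"
    using ex_is_arg_min_if_finite by blast
  then have F: "min_spanning_tree V E w F"
    by (simp add: min_spanning_tree_def)
  have "F' = F" if F': "min_spanning_tree V E w F'" for F'
  proof (rule set_eqI)
    fix e
    have sub: "F \<subseteq> E" "F' \<subseteq> E"
      using mst_spanning_tree F F' by (auto simp: spanning_tree_def)
    show "e \<in> F' \<longleftrightarrow> e \<in> F"
    proof (cases "e \<in> E")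
      case True
      then obtain x y where "e = {x, y}"
        using edges_card by (meson card_2_iff)
      then show ?thesis
        using mem_mst_iff F F' True by metis
    next
      case False
      then show ?thesis using sub by auto
    qed
  qed
  with F show ?thesis by blast
qed

lemma mem_the_mst_iff:
  assumes "{x, y} \<in> E"
  shows "{x, y} \<in> the_mst V E w \<longleftrightarrow> \<not> conn (lighter {x, y}) x y"
  using mem_mst_iff [OF _ assms] theI' [OF ex1_mst] by (simp add: the_mst_def)

end

section \<open>Cuts of the graph with hubs\<close>

lemma not_conn_iff:
  "\<not> conn L u v \<longleftrightarrow> (\<exists>S. u \<in> S \<and> v \<notin> S \<and> (\<forall>x y. {x, y} \<in> L \<longrightarrow> (x \<in> S \<longleftrightarrow> y \<in> S)))"
proof
  assume "\<not> conn L u v"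
  then show "\<exists>S. u \<in> S \<and> v \<notin> S \<and> (\<forall>x y. {x, y} \<in> L \<longrightarrow> (x \<in> S \<longleftrightarrow> y \<in> S))"
    by (intro exI [of _ "{x. conn L u x}"]) (auto intro: conn_step simp: insert_commute)
next
  assume "\<exists>S. u \<in> S \<and> v \<notin> S \<and> (\<forall>x y. {x, y} \<in> L \<longrightarrow> (x \<in> S \<longleftrightarrow> y \<in> S))"
  then obtain S where S: "u \<in> S" "v \<notin> S" "\<And>x y. {x, y} \<in> L \<Longrightarrow> x \<in> S \<longleftrightarrow> y \<in> S"
    by metis
  show "\<not> conn L u v"
  proof
    assume "conn L u v"
    then have "v \<in> S"
      by (induction rule: conn_induct) (use S in auto)
    then show False
      using S(2) by simp
  qed
qed

definition terminals :: "vertex set" where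
  "terminals = {Va, Vb, Vc, Vd}"

definition hub_edges :: "nat \<Rightarrow> vertex set set" where
  "hub_edges h = (\<lambda>(i, x). {Hub i, x}) ` ({..<h} \<times> terminals)"

lemma G_edges_eq: "G_edges h = insert edge_A (insert edge_B (hub_edges h))"
  unfolding G_edges_def hub_edges_def terminals_def hubs_def by (auto simp: image_iff)

text \<open>The pairs \<open>{a, b}\<close> and \<open>{c, d}\<close> are the edges \<open>A\<close> and \<open>B\<close> in one of the two orders, so that
  the cases \<open>w A < w B\<close> and \<open>w B < w A\<close> are treated at once.\<close>

definition roles :: "vertex \<Rightarrow> vertex \<Rightarrow> vertex \<Rightarrow> vertex \<Rightarrow> bool" where
  "roles a b c d \<longleftrightarrow> (a, b, c, d) = (Va, Vb, Vc, Vd) \<or> (a, b, c, d) = (Vc, Vd, Va, Vb)"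

lemma rolesD:
  assumes "roles a b c d"
  shows "terminals = {a, b, c, d}" "distinct [a, b, c, d]"
    "G_edges h = insert {a, b} (insert {c, d} (hub_edges h))"
  using assms by (auto simp: roles_def terminals_def G_edges_eq edge_A_def edge_B_def insert_commute)

lemma hub_edge_eq_iff:
  assumes "x \<in> terminals" "y \<in> terminals"
  shows "{Hub i, x} = {Hub j, y} \<longleftrightarrow> i = j \<and> x = y"
  using assms by (auto simp: terminals_def doubleton_eq_iff)

lemma pair_notin_hub_edges:
  assumes "x \<in> terminals" "y \<in> terminals"
  shows "{x, y} \<notin> hub_edges h"
  using assms by (auto simp: terminals_def hub_edges_def doubleton_eq_iff)

lemma roles_pairs:
  assumes "roles a b c d"
  shows "{a, b} \<noteq> {c, d}" "{a, b} \<notin> hub_edges h" "{c, d} \<notin> hub_edges h"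
proof -
  show "{a, b} \<noteq> {c, d}"
    using rolesD(2) [OF assms] by (simp add: doubleton_eq_iff)
qed (simp_all add: pair_notin_hub_edges rolesD(1) [OF assms])

lemma finite_hub_edges: "finite (hub_edges h)"
  by (simp add: hub_edges_def terminals_def)

lemma weighted_graph_G:
  assumes h: "1 \<le> h" and inj: "inj_on w (G_edges h)"
  shows "weighted_graph (G_verts h) (G_edges h) w"
proof
  show "finite (G_edges h)"
    by (simp add: G_edges_eq finite_hub_edges)
  show "card e = 2" if "e \<in> G_edges h" for e
    using that by (auto simp: G_edges_eq edge_A_def edge_B_def hub_edges_def terminals_def)
  show "e \<subseteq> G_verts h" if "e \<in> G_edges h" for e
    using that
    by (auto simp: G_edges_eq edge_A_def edge_B_def hub_edges_def terminals_def G_verts_def hubs_def)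
  show "G_verts h \<noteq> {}"
    by (simp add: G_verts_def)
  show "inj_on w (G_edges h)"
    by (rule inj)
  have edge: "{Hub i, x} \<in> G_edges h" if "i < h" "x \<in> terminals" for i x
    using that by (auto simp: G_edges_eq hub_edges_def)
  have hub0: "conn (G_edges h) (Hub 0) x" if "x \<in> terminals" for x
    using edge [of 0 x] h that by (simp add: conn_edge)
  have "conn (G_edges h) (Hub 0) (Hub i)" if "i < h" for i
  proof -
    have "{Va, Hub i} \<in> G_edges h"
      using edge [OF that, of Va] by (simp add: terminals_def insert_commute)
    then show ?thesis
      using hub0 [of Va] by (simp add: terminals_def conn_step)
  qed
  then have *: "conn (G_edges h) (Hub 0) v" if "v \<in> G_verts h" for v
    using that hub0 by (auto simp: G_verts_def hubs_def terminals_def)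
  then show "conn (G_edges h) u v" if "u \<in> G_verts h" "v \<in> G_verts h" for u v
    using that by (meson conn_sym conn_trans)
qed

definition noncrossing :: "'a set \<Rightarrow> 'a set \<Rightarrow> bool" where
  "noncrossing P L \<longleftrightarrow> L \<subseteq> P \<or> L \<inter> P = {}"

text \<open>Hubs are adjacent to terminals only, so a cut amounts to its trace \<open>P\<close> on
  the terminals, and a hub obstructs it only if it has neighbours on both sides. \<open>N i\<close>
  is the set of terminals joined to hub \<open>i\<close>, and \<open>D\<close> the set of edges
  between terminals.\<close>

lemma not_conn_hubs_iff:
  fixes N :: "nat \<Rightarrow> vertex set"
  assumes N: "\<And>i. N i \<subseteq> terminals" and D: "\<And>e. e \<in> D \<Longrightarrow> e \<subseteq> terminals"
    and uv: "u \<in> terminals" "v \<in> terminals"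
  shows "\<not> conn ((\<Union>i<h. (\<lambda>x. {Hub i, x}) ` N i) \<union> D) u v \<longleftrightarrow>
    (\<exists>P\<subseteq>terminals. u \<in> P \<and> v \<notin> P \<and> (\<forall>i<h. noncrossing P (N i)) \<and>
      (\<forall>x y. {x, y} \<in> D \<longrightarrow> (x \<in> P \<longleftrightarrow> y \<in> P)))" (is "\<not> conn ?L u v \<longleftrightarrow> ?rhs")
proof
  assume "\<not> conn ?L u v"
  then obtain S where S: "u \<in> S" "v \<notin> S" and closed: "\<forall>x y. {x, y} \<in> ?L \<longrightarrow> (x \<in> S \<longleftrightarrow> y \<in> S)"
    unfolding not_conn_iff by (elim exE conjE)
  have "noncrossing (S \<inter> terminals) (N i)" if "i < h" for i
  proof -
    have "Hub i \<in> S \<longleftrightarrow> x \<in> S" if "x \<in> N i" for x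
    proof (rule closed [rule_format])
      show "{Hub i, x} \<in> ?L"
        using that \<open>i < h\<close> by (intro UnI1 UN_I [of i] imageI) simp_all
    qed
    then have "N i \<subseteq> S \<or> N i \<inter> S = {}"
      by (metis disjoint_iff subsetI)
    then show ?thesis
      using N [of i] unfolding noncrossing_def by blast
  qed
  moreover have "x \<in> S \<inter> terminals \<longleftrightarrow> y \<in> S \<inter> terminals" if "{x, y} \<in> D" for x y
    using D [OF that] closed that by simp
  ultimately show ?rhs
    using S uv by (intro exI [of _ "S \<inter> terminals"]) simp
next
  assume ?rhs
  then obtain P where P: "P \<subseteq> terminals" "u \<in> P" "v \<notin> P"
    and nc: "\<forall>i<h. noncrossing P (N i)"
    and DP: "\<forall>x y. {x, y} \<in> D \<longrightarrow> (x \<in> P \<longleftrightarrow> y \<in> P)"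
    by (elim exE conjE)
  \<comment> \<open>A hub follows its neighbours to the side of \<open>P\<close>; a hub with no
    neighbour in \<open>P\<close> goes to the other side.\<close>
  define S where "S = P \<union> {Hub i | i. N i \<inter> P \<noteq> {}}"
  have term_iff: "x \<in> S \<longleftrightarrow> x \<in> P" if "x \<in> terminals" for x
    using that by (auto simp: S_def terminals_def)
  have hub_iff: "Hub i \<in> S \<longleftrightarrow> N i \<inter> P \<noteq> {}" for i
    using P(1) by (auto simp: S_def terminals_def)
  have hub_edge: "Hub i \<in> S \<longleftrightarrow> z \<in> S" if "i < h" "z \<in> N i" for i z
  proof -
    have "z \<in> S \<longleftrightarrow> z \<in> P"
      using term_iff N that(2) by (metis subsetD)
    then show ?thesis
      using nc that unfolding hub_iff noncrossing_def by (metis disjoint_iff subsetD)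
  qed
  have "x \<in> S \<longleftrightarrow> y \<in> S" if "{x, y} \<in> ?L" for x y
  proof (cases "{x, y} \<in> D")
    case True
    then have "x \<in> terminals" "y \<in> terminals"
      using D [OF True] by simp_all
    then show ?thesis
      using term_iff DP True by simp
  next
    case False
    then have "\<exists>i<h. \<exists>z\<in>N i. {x, y} = {Hub i, z}"
      using that by (simp only: Un_iff UN_iff image_iff lessThan_iff simp_thms Bex_def)
    then obtain i z where iz: "i < h" "z \<in> N i" and "{x, y} = {Hub i, z}"
      by (elim exE conjE bexE)
    then have "x = Hub i \<and> y = z \<or> x = z \<and> y = Hub i"
      by (metis doubleton_eq_iff)
    then show ?thesis
      using hub_edge [OF iz] by metis
  qed
  moreover have "u \<in> S" "v \<notin> S"
    using term_iff P uv by simp_all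
  ultimately show "\<not> conn ?L u v"
    unfolding not_conn_iff by (intro exI [of _ S]) simp
qed

lemma lighter_G_edges:
  assumes "roles a b c d"
  shows "{f \<in> G_edges h. w f < r} =
    (\<Union>i<h. (\<lambda>x. {Hub i, x}) ` {x \<in> terminals. w {Hub i, x} < r}) \<union> {e \<in> {{a, b}, {c, d}}. w e < r}"
  unfolding rolesD(3) [OF assms] hub_edges_def by auto

text \<open>The light edges at a hub do not cross the cut that separates one terminal from the three
  others, respectively two terminals from two others; \<open>p\<close>, \<open>q\<close>, \<open>r\<close>, \<open>s\<close> say which of
  the four edges at the hub are light.\<close>

definition cut1 :: "bool \<Rightarrow> bool \<Rightarrow> bool \<Rightarrow> bool \<Rightarrow> bool" where
  "cut1 p q r s \<longleftrightarrow> \<not> p \<or> \<not> q \<and> \<not> r \<and> \<not> s"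

definition cut2 :: "bool \<Rightarrow> bool \<Rightarrow> bool \<Rightarrow> bool \<Rightarrow> bool" where
  "cut2 p q r s \<longleftrightarrow> \<not> p \<and> \<not> q \<or> \<not> r \<and> \<not> s"

text \<open>A set and its complement give the same cut: \<open>{a, c, d}\<close> isolates
  \<open>b\<close>, and \<open>{a, b, c}\<close> isolates \<open>d\<close>.\<close>

lemma noncrossing_terminals:
  assumes "distinct [a, b, c, d]"
  shows "noncrossing {a} {x \<in> {a, b, c, d}. l x} \<longleftrightarrow> cut1 (l a) (l b) (l c) (l d)"
    and "noncrossing {a, c} {x \<in> {a, b, c, d}. l x} \<longleftrightarrow> cut2 (l a) (l c) (l b) (l d)"
    and "noncrossing {a, d} {x \<in> {a, b, c, d}. l x} \<longleftrightarrow> cut2 (l a) (l d) (l b) (l c)"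
    and "noncrossing {a, c, d} {x \<in> {a, b, c, d}. l x} \<longleftrightarrow> cut1 (l b) (l a) (l c) (l d)"
    and "noncrossing {c} {x \<in> {a, b, c, d}. l x} \<longleftrightarrow> cut1 (l c) (l a) (l b) (l d)"
    and "noncrossing {a, b, c} {x \<in> {a, b, c, d}. l x} \<longleftrightarrow> cut1 (l d) (l a) (l b) (l c)"
  using assms by (auto simp: noncrossing_def cut1_def cut2_def)

lemma ex_subset_four:
  assumes "distinct [a, b, c, d]"
  shows "(\<exists>P\<subseteq>{a, b, c, d}. a \<in> P \<and> b \<notin> P \<and> R P) \<longleftrightarrow> R {a} \<or> R {a, c} \<or> R {a, d} \<or> R {a, c, d}"
proof -
  have "(\<exists>P\<subseteq>{a, b, c, d}. a \<in> P \<and> b \<notin> P \<and> R P) \<longleftrightarrow>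
      (\<exists>P\<in>Pow {a, b, c, d}. a \<in> P \<and> b \<notin> P \<and> R P)"
    by (simp add: Bex_def)
  also have "\<dots> \<longleftrightarrow> R {a} \<or> R {a, c} \<or> R {a, d} \<or> R {a, c, d}"
    using assms by (simp add: Pow_insert bex_Un) argo
  finally show ?thesis .
qed

text \<open>Neither special edge is lighter than \<open>{a, b}\<close>, so no light edge runs
  between terminals and all four traces that separate \<open>a\<close> from \<open>b\<close>
  compete.\<close>

lemma lighter_edge_mem_mst_iff:
  assumes h: "1 \<le> h" and inj: "inj_on w (G_edges h)" and roles: "roles a b c d"
    and less: "w {a, b} < w {c, d}"
  defines "l \<equiv> \<lambda>i x. w {Hub i, x} < w {a, b}"
  shows "{a, b} \<in> the_mst (G_verts h) (G_edges h) w \<longleftrightarrow>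
    (\<forall>i<h. cut1 (l i a) (l i b) (l i c) (l i d)) \<or> (\<forall>i<h. cut2 (l i a) (l i c) (l i b) (l i d)) \<or>
    (\<forall>i<h. cut2 (l i a) (l i d) (l i b) (l i c)) \<or> (\<forall>i<h. cut1 (l i b) (l i a) (l i c) (l i d))"
proof -
  interpret weighted_graph "G_verts h" "G_edges h" w
    by (rule weighted_graph_G [OF h inj])
  note t = rolesD(1) [OF roles] and d = rolesD(2) [OF roles]
  have D: "{e \<in> {{a, b}, {c, d}}. w e < w {a, b}} = {}"
    using less by auto
  have lighter: "lighter {a, b} = (\<Union>i<h. (\<lambda>x. {Hub i, x}) ` {x \<in> terminals. l i x}) \<union> {}"
    unfolding lighter_def lighter_G_edges [OF roles] D l_def by simp
  have "{a, b} \<in> the_mst (G_verts h) (G_edges h) w \<longleftrightarrow> \<not> conn (lighter {a, b}) a b"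
    by (rule mem_the_mst_iff) (simp add: rolesD(3) [OF roles])
  also have "\<dots> \<longleftrightarrow> (\<exists>P\<subseteq>terminals. a \<in> P \<and> b \<notin> P \<and> (\<forall>i<h. noncrossing P {x \<in> terminals. l i x}))"
    unfolding lighter by (subst not_conn_hubs_iff) (simp_all add: t subset_iff)
  finally show ?thesis
    unfolding t ex_subset_four [OF d] noncrossing_terminals [OF d] .
qed

text \<open>The light edge \<open>{a, b}\<close> keeps \<open>a\<close> and \<open>b\<close> on one
  side, which leaves only the cuts isolating \<open>c\<close> or \<open>d\<close>.\<close>

lemma heavier_edge_mem_mst_iff:
  assumes h: "1 \<le> h" and inj: "inj_on w (G_edges h)" and roles: "roles a b c d"
    and less: "w {a, b} < w {c, d}"
  defines "l \<equiv> \<lambda>i x. w {Hub i, x} < w {c, d}"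
  shows "{c, d} \<in> the_mst (G_verts h) (G_edges h) w \<longleftrightarrow>
    (\<forall>i<h. cut1 (l i c) (l i a) (l i b) (l i d)) \<or> (\<forall>i<h. cut1 (l i d) (l i a) (l i b) (l i c))"
proof -
  interpret weighted_graph "G_verts h" "G_edges h" w
    by (rule weighted_graph_G [OF h inj])
  note t = rolesD(1) [OF roles] and d = rolesD(2) [OF roles]
  have d': "distinct [c, d, a, b]"
    using d by auto
  have D: "{e \<in> {{a, b}, {c, d}}. w e < w {c, d}} = {{a, b}}"
    using less by auto
  have lighter: "lighter {c, d} = (\<Union>i<h. (\<lambda>x. {Hub i, x}) ` {x \<in> terminals. l i x}) \<union> {{a, b}}"
    unfolding lighter_def lighter_G_edges [OF roles] D l_def by simp
  have same_side: "(\<forall>x y. {x, y} = {a, b} \<longrightarrow> (x \<in> P \<longleftrightarrow> y \<in> P)) \<longleftrightarrow> (a \<in> P \<longleftrightarrow> b \<in> P)" for P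
    by (auto simp: doubleton_eq_iff)
  have t': "terminals = {c, d, a, b}"
    using t by auto
  have "{c, d} \<in> the_mst (G_verts h) (G_edges h) w \<longleftrightarrow> \<not> conn (lighter {c, d}) c d"
    by (rule mem_the_mst_iff) (simp add: rolesD(3) [OF roles])
  also have "\<dots> \<longleftrightarrow> (\<exists>P\<subseteq>terminals. c \<in> P \<and> d \<notin> P \<and>
      (\<forall>i<h. noncrossing P {x \<in> terminals. l i x}) \<and> (a \<in> P \<longleftrightarrow> b \<in> P))"
    unfolding lighter by (subst not_conn_hubs_iff) (simp_all add: t same_side subset_iff)
  also have "\<dots> \<longleftrightarrow> (\<forall>i<h. noncrossing {c} {x \<in> terminals. l i x}) \<or>
      (\<forall>i<h. noncrossing {c, a, b} {x \<in> terminals. l i x})"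
    using d d' not_sym [of a b] unfolding t' ex_subset_four [OF d'] by simp
  also have "{c, a, b} = {a, b, c}"
    by auto
  finally show ?thesis
    unfolding t noncrossing_terminals [OF d] .
qed

section \<open>Patterns in a finite product measure\<close>

text \<open>The coordinates form independent blocks indexed by \<open>I\<close>. The event is a
  disjoint union of boxes, one for each choice \<open>g\<close> of a good pattern in every block,
  and the sum over \<open>g\<close> of the products factors into a power.\<close>

lemma measure_product_patterns:
  fixes N :: "'y measure" and L :: "'y \<Rightarrow> 'k" and e :: "'i \<Rightarrow> 'x \<Rightarrow> 'e"
  assumes N: "prob_space N" and fin: "finite I" "finite X" "finite good"
    and bij: "bij_betw (\<lambda>(i, v). e i v) (I \<times> X) H"
    and good: "good \<subseteq> X \<rightarrow>\<^sub>E UNIV"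
    and L: "\<And>k. {y \<in> space N. L y = k} \<in> sets N"
  shows "measure (PiM H (\<lambda>_. N)) {x \<in> space (PiM H (\<lambda>_. N)). \<forall>i\<in>I. (\<lambda>v\<in>X. L (x (e i v))) \<in> good} =
    (\<Sum>f\<in>good. \<Prod>v\<in>X. measure N {y \<in> space N. L y = f v}) ^ card I"
proof -
  interpret N: prob_space N by (rule N)
  have "finite H"
    using bij fin by (metis bij_betw_finite finite_cartesian_product)
  then interpret P: finite_product_prob_space "\<lambda>_. N" H
    by unfold_locales
  let ?p = "\<lambda>k. measure N {y \<in> space N. L y = k}"
  let ?e' = "the_inv_into (I \<times> X) (\<lambda>(i, v). e i v)"
  \<comment> \<open>\<open>lab\<close> transports prescribed labels from index pairs to coordinates
    in \<open>H\<close> along the inverse bijection.\<close>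
  define lab where "lab g = (\<lambda>k. case ?e' k of (i, v) \<Rightarrow> g i v)" for g :: "'i \<Rightarrow> 'x \<Rightarrow> 'k"
  have inj: "inj_on (\<lambda>(i, v). e i v) (I \<times> X)" and H: "H = (\<lambda>(i, v). e i v) ` (I \<times> X)"
    using bij by (simp_all add: bij_betw_def)
  have lab: "lab g (e i v) = g i v" if "i \<in> I" "v \<in> X" for g i v
    using the_inv_into_f_f [OF inj, of "(i, v)"] that by (simp add: lab_def)
  have memH: "e i v \<in> H" if "i \<in> I" "v \<in> X" for i v
    using that by (auto simp: H)
  define box where "box g = PiE H (\<lambda>k. {y \<in> space N. L y = lab g k})" for g
  have box_iff: "x \<in> box g \<longleftrightarrow> x \<in> space (PiM H (\<lambda>_. N)) \<and> (\<forall>i\<in>I. \<forall>v\<in>X. L (x (e i v)) = g i v)" for x g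
  proof -
    have "(\<forall>k\<in>H. L (x k) = lab g k) \<longleftrightarrow> (\<forall>i\<in>I. \<forall>v\<in>X. L (x (e i v)) = g i v)"
      by (simp add: H lab cong: ball_cong)
    then show ?thesis
      by (auto simp: box_def space_PiM PiE_iff)
  qed
  let ?G = "PiE I (\<lambda>_. good)"
  \<comment> \<open>Good patterns are determined by their values on \<open>X\<close>; this is what
    makes boxes for different choices disjoint.\<close>
  have goodD: "f v = undefined" if "f \<in> good" "v \<notin> X" for f v
    using good that by (auto simp: PiE_def extensional_def)
  have "{x \<in> space (PiM H (\<lambda>_. N)). \<forall>i\<in>I. (\<lambda>v\<in>X. L (x (e i v))) \<in> good} = (\<Union>g\<in>?G. box g)"
    (is "?S = _")
  proof (intro set_eqI iffI)
    fix x assume x: "x \<in> ?S"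
    define g where "g = (\<lambda>i\<in>I. \<lambda>v\<in>X. L (x (e i v)))"
    have "g \<in> ?G" "x \<in> box g"
      using x by (auto simp: g_def box_iff)
    then show "x \<in> (\<Union>g\<in>?G. box g)"
      by blast
  next
    fix x assume "x \<in> (\<Union>g\<in>?G. box g)"
    then obtain g where g: "g \<in> ?G" and x: "x \<in> box g"
      by blast
    have "(\<lambda>v\<in>X. L (x (e i v))) = g i" if "i \<in> I" for i
    proof -
      have "g i \<in> good"
        using g that by auto
      then have "g i v = undefined" if "v \<notin> X" for v
        using goodD that by metis
      then show ?thesis
        using x that by (auto simp: box_iff fun_eq_iff restrict_def)
    qed
    then show "x \<in> ?S"
      using x g by (auto simp: box_iff)
  qed
  moreover have "measure (PiM H (\<lambda>_. N)) (\<Union>g\<in>?G. box g) = (\<Sum>g\<in>?G. measure (PiM H (\<lambda>_. N)) (box g))"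
  proof (rule P.finite_measure_finite_Union)
    show "finite ?G"
      using fin by (simp add: finite_PiE)
    show "box ` ?G \<subseteq> sets (PiM H (\<lambda>_. N))"
      using L \<open>finite H\<close> by (auto simp: box_def intro!: sets_PiM_I_finite)
    show "disjoint_family_on box ?G"
      unfolding disjoint_family_on_def
    proof (intro ballI impI)
      fix g g' assume g: "g \<in> ?G" "g' \<in> ?G" "g \<noteq> g'"
      then obtain i where i: "i \<in> I" "g i \<noteq> g' i"
        by (metis PiE_ext)
      then have "g i \<in> good" "g' i \<in> good"
        using g by auto
      then obtain v where "v \<in> X" "g i v \<noteq> g' i v"
        using i goodD by (metis ext)
      then show "box g \<inter> box g' = {}"
        using i by (auto simp: box_iff)
    qed
  qed
  moreover have "measure (PiM H (\<lambda>_. N)) (box g) = (\<Prod>i\<in>I. \<Prod>v\<in>X. ?p (g i v))" for g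
  proof -
    have "measure (PiM H (\<lambda>_. N)) (box g) = (\<Prod>k\<in>H. ?p (lab g k))"
      unfolding box_def by (rule P.prob_times) (rule L)
    also have "\<dots> = (\<Prod>(i, v)\<in>I \<times> X. ?p (lab g (e i v)))"
      using prod.reindex_bij_betw [OF bij, of "\<lambda>k. ?p (lab g k)"] by (simp add: case_prod_unfold)
    also have "\<dots> = (\<Prod>i\<in>I. \<Prod>v\<in>X. ?p (lab g (e i v)))"
      by (simp add: prod.cartesian_product)
    also have "\<dots> = (\<Prod>i\<in>I. \<Prod>v\<in>X. ?p (g i v))"
      by (intro prod.cong refl) (simp add: lab)
    finally show ?thesis .
  qed
  moreover have "(\<Sum>g\<in>?G. \<Prod>i\<in>I. \<Prod>v\<in>X. ?p (g i v)) = (\<Prod>i\<in>I. \<Sum>f\<in>good. \<Prod>v\<in>X. ?p (f v))"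
    using fin by (intro prod_sum_PiE [symmetric]) auto
  ultimately show ?thesis
    by simp
qed

text \<open>\<open>s\<close> and \<open>t\<close> stand for the lighter and the heavier of the two
  special weights. The cuts compare hub edges with these weights only: at \<open>s\<close> light
  means level 0, at \<open>t\<close> it means level 0 or 1.\<close>

definition level :: "real \<Rightarrow> real \<Rightarrow> real \<Rightarrow> nat" where
  "level s t x = (if x < s then 0 else if x < t then 1 else 2)"

type_synonym pattern = "nat \<Rightarrow> nat \<Rightarrow> nat \<Rightarrow> nat \<Rightarrow> bool"

definition level_prob :: "real \<Rightarrow> real \<Rightarrow> nat \<Rightarrow> real" where
  "level_prob u v k = (if k = 0 then u else if k = 1 then v - u else 1 - v)"

text \<open>The sum over all 81 level quadruples at a hub, with \<open>u\<close> and
  \<open>v\<close> the distribution function at the two weights; kept explicit so that every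
  polynomial needed results from mere expansion.\<close>

definition pattern_prob :: "pattern \<Rightarrow> real \<Rightarrow> real \<Rightarrow> real" where
  "pattern_prob K u v = (\<Sum>p<3. \<Sum>q<3. \<Sum>r<3. \<Sum>s<3.
     if K p q r s then level_prob u v p * level_prob u v q * level_prob u v r * level_prob u v s else 0)"

lemma sum_four_functions:
  fixes w :: "'k \<Rightarrow> 'c :: comm_semiring_1"
  assumes d: "distinct [a, b, c, d]" and A: "finite A"
  shows "(\<Sum>f\<in>{f \<in> {a, b, c, d} \<rightarrow>\<^sub>E A. K (f a) (f b) (f c) (f d)}. \<Prod>v\<in>{a, b, c, d}. w (f v)) =
    (\<Sum>p\<in>A. \<Sum>q\<in>A. \<Sum>r\<in>A. \<Sum>s\<in>A. if K p q r s then w p * w q * w r * w s else 0)"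
proof -
  let ?F = "{a, b, c, d} \<rightarrow>\<^sub>E A"
  have fin: "finite ?F"
    using A by (intro finite_PiE) auto
  have "(\<Sum>f\<in>{f \<in> ?F. K (f a) (f b) (f c) (f d)}. \<Prod>v\<in>{a, b, c, d}. w (f v)) =
      (\<Sum>f\<in>?F. if K (f a) (f b) (f c) (f d) then w (f a) * w (f b) * w (f c) * w (f d) else 0)"
    using d fin by (simp add: sum.inter_filter mult.assoc cong: if_cong)
  also have "\<dots> = (\<Sum>(p, q, r, s)\<in>A \<times> A \<times> A \<times> A. if K p q r s then w p * w q * w r * w s else 0)"
    by (rule sum.reindex_bij_witness [where
          j = "\<lambda>f. (f a, f b, f c, f d)" and
          i = "\<lambda>(p, q, r, s). \<lambda>v\<in>{a, b, c, d}. if v = a then p else if v = b then q else if v = c then r else s"])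
      (use d in \<open>auto simp: fun_eq_iff PiE_iff extensional_def restrict_def\<close>)
  finally show ?thesis
    by (simp add: sum.cartesian_product)
qed

lemma bij_betw_hub_edges:
  "bij_betw (\<lambda>(i, x). {Hub i, x}) ({..<h} \<times> terminals) (hub_edges h)"
  unfolding bij_betw_def hub_edges_def
  by (auto simp: inj_on_def hub_edge_eq_iff)

definition hub_pattern :: "vertex \<Rightarrow> vertex \<Rightarrow> vertex \<Rightarrow> vertex \<Rightarrow> pattern \<Rightarrow>
    real \<Rightarrow> real \<Rightarrow> (vertex set \<Rightarrow> real) \<Rightarrow> nat \<Rightarrow> bool" where
  "hub_pattern a b c d K s t x i \<longleftrightarrow>
    K (level s t (x {Hub i, a})) (level s t (x {Hub i, b})) (level s t (x {Hub i, c})) (level s t (x {Hub i, d}))"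

definition pattern_event ::
    "nat \<Rightarrow> vertex \<Rightarrow> vertex \<Rightarrow> vertex \<Rightarrow> vertex \<Rightarrow> pattern \<Rightarrow> (vertex set \<Rightarrow> real) \<Rightarrow> bool" where
  "pattern_event h a b c d K x \<longleftrightarrow>
    x {a, b} < x {c, d} \<and> (\<forall>i\<in>{..<h}. hub_pattern a b c d K (x {a, b}) (x {c, d}) x i)"

lemma measure_hub_patterns:
  fixes law :: "real measure"
  assumes law: "prob_space law" "sets law = sets borel" and roles: "roles a b c d"
    and levels: "\<And>k. k < 3 \<Longrightarrow> measure law {x. level s t x = k} = level_prob u v k"
  shows "measure (PiM (hub_edges h) (\<lambda>_. law)) {x \<in> space (PiM (hub_edges h) (\<lambda>_. law)).
      \<forall>i\<in>{..<h}. hub_pattern a b c d K s t x i} = pattern_prob K u v ^ h"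
proof -
  note t = rolesD(1) [OF roles] and d = rolesD(2) [OF roles]
  let ?good = "{f \<in> {a, b, c, d} \<rightarrow>\<^sub>E {..<3}. K (f a) (f b) (f c) (f d)}"
  have sp: "space law = UNIV"
    using sets_eq_imp_space_eq [OF law(2)] by simp
  have meas: "{x. level s t x = k} \<in> sets law" for k
    unfolding level_def law(2) by measurable
  have lt3: "level s t x < 3" for x
    by (simp add: level_def)
  have good_iff: "(\<lambda>v\<in>{a, b, c, d}. level s t (x {Hub i, v})) \<in> ?good \<longleftrightarrow> hub_pattern a b c d K s t x i" for x i
    using d lt3 by (auto simp: hub_pattern_def)
  have "measure (PiM (hub_edges h) (\<lambda>_. law)) {x \<in> space (PiM (hub_edges h) (\<lambda>_. law)).
      \<forall>i\<in>{..<h}. (\<lambda>v\<in>{a, b, c, d}. level s t (x {Hub i, v})) \<in> ?good} =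
    (\<Sum>f\<in>?good. \<Prod>v\<in>{a, b, c, d}. measure law {y \<in> space law. level s t y = f v}) ^ card {..<h}"
  proof (rule measure_product_patterns [OF law(1)])
    show "finite ?good"
      by (rule finite_subset [of _ "{a, b, c, d} \<rightarrow>\<^sub>E {..<3}"]) (auto intro: finite_PiE)
    show "bij_betw (\<lambda>(i, v). {Hub i, v}) ({..<h} \<times> {a, b, c, d}) (hub_edges h)"
      using bij_betw_hub_edges unfolding t .
    show "?good \<subseteq> {a, b, c, d} \<rightarrow>\<^sub>E UNIV"
      by auto
    show "{y \<in> space law. level s t y = k} \<in> sets law" for k
      using meas by (simp add: sp)
  qed simp_all
  also have "(\<Sum>f\<in>?good. \<Prod>x\<in>{a, b, c, d}. measure law {y \<in> space law. level s t y = f x}) =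
      (\<Sum>f\<in>?good. \<Prod>x\<in>{a, b, c, d}. level_prob u v (f x))"
  proof (intro sum.cong prod.cong refl)
    fix f x assume "f \<in> ?good" "x \<in> {a, b, c, d}"
    then have "f x < 3"
      by (auto simp: PiE_iff)
    then show "measure law {y \<in> space law. level s t y = f x} = level_prob u v (f x)"
      using levels by (simp add: sp)
  qed
  also have "\<dots> = pattern_prob K u v"
    unfolding sum_four_functions [OF d finite_lessThan] pattern_prob_def ..
  finally show ?thesis
    unfolding good_iff by simp
qed

context
  fixes law :: "real measure"
  assumes law: "prob_space law" "sets law = sets borel" and atomless: "\<And>x. emeasure law {x} = 0"
begin

lemma real_distribution_law: "real_distribution law"
  using law sets_eq_imp_space_eq [OF law(2)]
  by (simp add: real_distribution_def real_distribution_axioms_def)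

text \<open>Without atoms, \<open>x < s\<close> and \<open>x \<le> s\<close> have the same
  probability, so the levels can be read off the distribution function.\<close>

lemma measure_level:
  assumes "s < t" "k < 3"
  shows "measure law {x. level s t x = k} = level_prob (cdf law s) (cdf law t) k"
proof -
  interpret real_distribution law
    by (rule real_distribution_law)
  have lessThan: "measure law {..<x} = cdf law x" for x
  proof -
    have "measure law {x} = 0"
      using atomless by (simp add: measure_def)
    moreover have "{..x} = {..<x} \<union> {x}"
      by auto
    then have "measure law {..x} = measure law {..<x} + measure law {x}"
      by (simp only:) (rule finite_measure_Union, auto)
    ultimately show ?thesis
      unfolding cdf_def by simp
  qed
  consider "k = 0" | "k = 1" | "k = 2"
    using assms(2) by linarith
  then show ?thesis
  proof cases
    case 1
    have "{x. level s t x = 0} = {..<s}"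
      by (auto simp: level_def)
    then show ?thesis
      using 1 by (simp add: lessThan level_prob_def)
  next
    case 2
    have "{x. level s t x = 1} = {..<t} - {..<s}"
      using assms(1) by (auto simp: level_def split: if_splits)
    then have "measure law {x. level s t x = 1} = measure law {..<t} - measure law {..<s}"
      using assms(1) by (simp only:) (rule finite_measure_Diff, auto)
    then show ?thesis
      using 2 by (simp add: lessThan level_prob_def)
  next
    case 3
    have "{x. level s t x = 2} = space law - {..<t}"
      using assms(1) by (auto simp: level_def split: if_splits)
    then have "measure law {x. level s t x = 2} = 1 - measure law {..<t}"
      by (simp add: prob_compl del: space_eq_univ)
    then show ?thesis
      using 3 by (simp add: lessThan level_prob_def)
  qed
qed

lemma measurable_pattern_event:
  assumes roles: "roles a b c d"
  shows "Measurable.pred (PiM (G_edges h) (\<lambda>_. law)) (pattern_event h a b c d K)"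
proof -
  let ?P = "PiM (G_edges h) (\<lambda>_. law)"
  have proj: "(\<lambda>x. x e) \<in> borel_measurable ?P" if "e \<in> G_edges h" for e
    using measurable_component_singleton [OF that, of "\<lambda>_. law"] measurable_cong_sets [OF refl law(2)]
    by blast
  have AB [measurable]: "(\<lambda>x. x {a, b}) \<in> borel_measurable ?P" "(\<lambda>x. x {c, d}) \<in> borel_measurable ?P"
    by (rule proj, simp add: rolesD(3) [OF roles])+
  have lev: "(\<lambda>x. level (x {a, b}) (x {c, d}) (x {Hub i, y})) \<in> measurable ?P (count_space UNIV)"
    if "i < h" "y \<in> {a, b, c, d}" for i y
  proof -
    have "{Hub i, y} \<in> hub_edges h"
      using that rolesD(1) [OF roles] unfolding hub_edges_def by (intro image_eqI [of _ _ "(i, y)"]) simp_all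
    then have [measurable]: "(\<lambda>x. x {Hub i, y}) \<in> borel_measurable ?P"
      by (intro proj) (simp add: rolesD(3) [OF roles])
    show ?thesis
      unfolding level_def by measurable
  qed
  have "Measurable.pred ?P (\<lambda>x. hub_pattern a b c d K (x {a, b}) (x {c, d}) x i)" if "i < h" for i
  proof -
    note [measurable] = lev [OF that, of a, simplified] lev [OF that, of b, simplified]
      lev [OF that, of c, simplified] lev [OF that, of d, simplified]
    show ?thesis
      unfolding hub_pattern_def by measurable
  qed
  then show ?thesis
    unfolding pattern_event_def
    by (intro pred_intros_logic(3) pred_intros_finite(3) borel_measurable_less AB finite_lessThan)
      simp_all
qed

text \<open>The coordinates \<open>{a, b}\<close> and \<open>{c, d}\<close> are split off one after
  the other; with their values \<open>s < t\<close> fixed, the remaining product over hub edges is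
  covered by \<open>measure_hub_patterns\<close>.\<close>

lemma emeasure_pattern_event:
  assumes roles: "roles a b c d"
  shows "emeasure (PiM (G_edges h) (\<lambda>_. law))
      {x \<in> space (PiM (G_edges h) (\<lambda>_. law)). pattern_event h a b c d K x} =
    (\<integral>\<^sup>+ s. \<integral>\<^sup>+ t. (if s < t then ennreal (pattern_prob K (cdf law s) (cdf law t) ^ h) else 0) \<partial>law \<partial>law)"
proof -
  interpret law: prob_space law by (rule law)
  interpret product_sigma_finite "\<lambda>_. law"
    by unfold_locales
  let ?A = "{a, b}" and ?B = "{c, d}" and ?H = "hub_edges h"
  let ?P = "\<lambda>I. PiM I (\<lambda>_. law)"
  note pairs = roles_pairs [OF roles]
  have E: "G_edges h = insert ?A (insert ?B ?H)"
    by (rule rolesD(3) [OF roles])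
  have sp: "space law = UNIV"
    using sets_eq_imp_space_eq [OF law(2)] by simp
  define S where "S = {x \<in> space (?P (G_edges h)). pattern_event h a b c d K x}"
  have S: "S \<in> sets (?P (insert ?A (insert ?B ?H)))"
    using measurable_pattern_event [OF roles, of h K] unfolding S_def pred_def E by simp
  have upd_A: "(\<lambda>x. x(?A := s)) \<in> measurable (?P (insert ?B ?H)) (?P (insert ?A (insert ?B ?H)))" for s
    by (rule measurable_fun_upd [of _ "insert ?B ?H" ?A]) (simp_all add: sp)
  have upd_B: "(\<lambda>x. x(?B := t)) \<in> measurable (?P ?H) (?P (insert ?B ?H))" for t
    by (rule measurable_fun_upd [of _ ?H ?B]) (simp_all add: sp)
  have inner: "(\<integral>\<^sup>+ x. indicator S (x(?B := t, ?A := s)) \<partial>?P ?H) =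
      (if s < t then ennreal (pattern_prob K (cdf law s) (cdf law t) ^ h) else 0)" for s t
  proof -
    have mem: "x(?B := t, ?A := s) \<in> S \<longleftrightarrow> s < t \<and> (\<forall>i\<in>{..<h}. hub_pattern a b c d K s t x i)"
      if "x \<in> space (?P ?H)" for x
    proof -
      have "x(?B := t, ?A := s) \<in> space (?P (G_edges h))"
        using measurable_space [OF upd_A measurable_space [OF upd_B that]] unfolding E .
      moreover have "{Hub i, y} \<noteq> ?A" "{Hub i, y} \<noteq> ?B" for i y
        using roles by (auto simp: roles_def doubleton_eq_iff)
      ultimately show ?thesis
        using pairs(1) by (simp add: S_def pattern_event_def hub_pattern_def)
    qed
    show ?thesis
    proof (cases "s < t")
      case True
      let ?S = "{x \<in> space (?P ?H). \<forall>i\<in>{..<h}. hub_pattern a b c d K s t x i}"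
      have "?S = (\<lambda>x. x(?B := t, ?A := s)) -` S \<inter> space (?P ?H)"
        using mem True by auto
      also have "\<dots> \<in> sets (?P ?H)"
        using measurable_compose [OF upd_B upd_A] S by (rule measurable_sets)
      finally have S': "?S \<in> sets (?P ?H)" .
      have "(\<integral>\<^sup>+ x. indicator S (x(?B := t, ?A := s)) \<partial>?P ?H) = (\<integral>\<^sup>+ x. indicator ?S x \<partial>?P ?H)"
        by (rule nn_integral_cong) (auto simp: indicator_def mem True)
      also have "\<dots> = emeasure (?P ?H) ?S"
        by (rule nn_integral_indicator [OF S'])
      also have "\<dots> = ennreal (measure (?P ?H) ?S)"
      proof -
        interpret H: prob_space "?P ?H"
          by (rule prob_space_PiM) (rule law)
        show ?thesis
          by (rule H.emeasure_eq_measure)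
      qed
      also have "measure (?P ?H) ?S = pattern_prob K (cdf law s) (cdf law t) ^ h"
        by (rule measure_hub_patterns [OF law roles measure_level [OF True]])
      finally show ?thesis
        by (simp only: True if_True)
    next
      case False
      have "(\<integral>\<^sup>+ x. indicator S (x(?B := t, ?A := s)) \<partial>?P ?H) = (\<integral>\<^sup>+ x. 0 \<partial>?P ?H)"
        by (rule nn_integral_cong) (simp add: mem False)
      then show ?thesis
        by (simp only: False if_False nn_integral_0_iff_AE nn_integral_const mult_zero_left)
    qed
  qed
  have "emeasure (?P (G_edges h)) S = (\<integral>\<^sup>+ x. indicator S x \<partial>?P (insert ?A (insert ?B ?H)))"
    using S unfolding E by simp
  also have "\<dots> = (\<integral>\<^sup>+ s. \<integral>\<^sup>+ x. indicator S (x(?A := s)) \<partial>?P (insert ?B ?H) \<partial>law)"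
    using S pairs by (subst product_nn_integral_insert_rev) (simp_all add: finite_hub_edges)
  also have "\<dots> = (\<integral>\<^sup>+ s. \<integral>\<^sup>+ t. \<integral>\<^sup>+ x. indicator S (x(?B := t, ?A := s)) \<partial>?P ?H \<partial>law \<partial>law)"
  proof (rule nn_integral_cong)
    fix s
    have "(\<lambda>x. indicator S (x(?A := s)) :: ennreal) \<in> borel_measurable (?P (insert ?B ?H))"
      using measurable_compose [OF upd_A borel_measurable_indicator [OF S]] .
    then show "(\<integral>\<^sup>+ x. indicator S (x(?A := s)) \<partial>?P (insert ?B ?H)) =
        (\<integral>\<^sup>+ t. \<integral>\<^sup>+ x. indicator S (x(?B := t, ?A := s)) \<partial>?P ?H \<partial>law)"
      using pairs by (intro product_nn_integral_insert_rev) (simp_all add: finite_hub_edges)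
  qed
  finally show ?thesis
    unfolding inner unfolding S_def .
qed

end

section \<open>Reduction to uniform weights\<close>

abbreviation unit_interval :: "real measure" where
  "unit_interval \<equiv> restrict_space lborel {0<..<1}"

lemma prob_space_unit_interval: "prob_space unit_interval"
  by (auto simp: space_restrict_space emeasure_restrict_space intro!: prob_spaceI)

definition triangle_integral :: "(real \<Rightarrow> real \<Rightarrow> real) \<Rightarrow> real" where
  "triangle_integral f = (\<integral>z. (if fst z < snd z then f (fst z) (snd z) else 0) \<partial>(unit_interval \<Otimes>\<^sub>M unit_interval))"

text \<open>Continuity supplies measurability, and boundedness on the compact unit square, hence
  integrability.\<close>

definition continuous2 :: "(real \<Rightarrow> real \<Rightarrow> real) \<Rightarrow> bool" where
  "continuous2 f \<longleftrightarrow> continuous_on UNIV (\<lambda>z. f (fst z) (snd z))"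

lemma continuous2_measurable:
  assumes "continuous2 f" "g \<in> borel_measurable M" "k \<in> borel_measurable M"
  shows "(\<lambda>x. f (g x) (k x)) \<in> borel_measurable M"
proof -
  have "(\<lambda>z. f (fst z) (snd z)) \<in> borel_measurable borel"
    using assms(1) unfolding continuous2_def by (rule borel_measurable_continuous_onI)
  moreover have "(\<lambda>x. (g x, k x)) \<in> borel_measurable M"
    using assms(2,3) by (rule borel_measurable_Pair)
  ultimately show ?thesis
    using measurable_compose [of "\<lambda>x. (g x, k x)" M borel "\<lambda>z. f (fst z) (snd z)" borel] by simp
qed

lemma measurable_unit_coordinates [measurable]:
  "fst \<in> borel_measurable (unit_interval \<Otimes>\<^sub>M unit_interval)"
  "snd \<in> borel_measurable (unit_interval \<Otimes>\<^sub>M unit_interval)"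
proof -
  have id: "(\<lambda>x. x) \<in> borel_measurable unit_interval"
    by (rule measurable_restrict_space1) simp
  show "fst \<in> borel_measurable (unit_interval \<Otimes>\<^sub>M unit_interval)"
    using measurable_compose [OF measurable_fst [of unit_interval unit_interval] id] by simp
  show "snd \<in> borel_measurable (unit_interval \<Otimes>\<^sub>M unit_interval)"
    using measurable_compose [OF measurable_snd [of unit_interval unit_interval] id] by simp
qed

lemma triangle_measurable:
  assumes "continuous2 f"
  shows "(\<lambda>z. if fst z < snd z then f (fst z) (snd z) else 0)
    \<in> borel_measurable (unit_interval \<Otimes>\<^sub>M unit_interval)"
proof -
  have [measurable]: "(\<lambda>z. f (fst z) (snd z)) \<in> borel_measurable (unit_interval \<Otimes>\<^sub>M unit_interval)"
    by (rule continuous2_measurable [OF assms]) measurable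
  show ?thesis
    by measurable
qed

lemma triangle_integrable:
  assumes "continuous2 f"
  shows "integrable (unit_interval \<Otimes>\<^sub>M unit_interval) (\<lambda>z. if fst z < snd z then f (fst z) (snd z) else 0)"
proof -
  interpret U: prob_space unit_interval
    by (rule prob_space_unit_interval)
  interpret P: pair_prob_space unit_interval unit_interval ..
  let ?Q = "{0..1::real} \<times> {0..1::real}"
  have "compact ((\<lambda>z. f (fst z) (snd z)) ` ?Q)"
    using assms unfolding continuous2_def
    by (intro compact_continuous_image compact_Times compact_Icc)
      (rule continuous_on_subset [OF _ subset_UNIV])
  then have "bounded ((\<lambda>z. f (fst z) (snd z)) ` ?Q)"
    by (rule compact_imp_bounded)
  then obtain B where "\<forall>y \<in> (\<lambda>z. f (fst z) (snd z)) ` ?Q. norm y \<le> B"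
    unfolding bounded_iff by (elim exE)
  then have B: "norm (f (fst z) (snd z)) \<le> B" if "z \<in> ?Q" for z
    using that by (rule bspec [OF _ imageI])
  show ?thesis
  proof (rule P.integrable_const_bound)
    show "AE z in unit_interval \<Otimes>\<^sub>M unit_interval. norm (if fst z < snd z then f (fst z) (snd z) else 0) \<le> B"
    proof (rule AE_I2)
      fix z assume "z \<in> space (unit_interval \<Otimes>\<^sub>M unit_interval)"
      then have "z \<in> ?Q"
        by (auto simp: space_pair_measure space_restrict_space)
      then show "norm (if fst z < snd z then f (fst z) (snd z) else 0) \<le> B"
        using B [OF \<open>z \<in> ?Q\<close>] order.trans [OF norm_ge_zero B [OF \<open>z \<in> ?Q\<close>]] by simp
    qed
  qed (rule triangle_measurable [OF assms])
qed

text \<open>Passing to a real-valued integral is what later permits linear expansion with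
  coefficients of either sign.\<close>

lemma nn_triangle_integral:
  assumes f: "continuous2 f" and nonneg: "\<And>u v. 0 < u \<Longrightarrow> u < v \<Longrightarrow> v < 1 \<Longrightarrow> 0 \<le> f u v"
  shows "(\<integral>\<^sup>+ u. \<integral>\<^sup>+ v. (if u < v then ennreal (f u v) else 0) \<partial>unit_interval \<partial>unit_interval) =
      ennreal (triangle_integral f)"
    and "0 \<le> triangle_integral f"
proof -
  interpret U: prob_space unit_interval
    by (rule prob_space_unit_interval)
  interpret P: pair_prob_space unit_interval unit_interval ..
  let ?g = "\<lambda>z. if fst z < snd z then f (fst z) (snd z) else 0"
  have pos: "0 \<le> ?g z" if "z \<in> space (unit_interval \<Otimes>\<^sub>M unit_interval)" for z
    using that nonneg by (auto simp: space_pair_measure space_restrict_space)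
  have "(\<integral>\<^sup>+ u. \<integral>\<^sup>+ v. (if u < v then ennreal (f u v) else 0) \<partial>unit_interval \<partial>unit_interval) =
      (\<integral>\<^sup>+ u. \<integral>\<^sup>+ v. ennreal (?g (u, v)) \<partial>unit_interval \<partial>unit_interval)"
    by (intro nn_integral_cong) simp
  also have "\<dots> = (\<integral>\<^sup>+ z. ennreal (?g z) \<partial>(unit_interval \<Otimes>\<^sub>M unit_interval))"
    using measurable_compose [OF triangle_measurable [OF f] measurable_ennreal]
    by (intro U.nn_integral_fst) simp
  also have "\<dots> = ennreal (triangle_integral f)"
    unfolding triangle_integral_def
    by (rule nn_integral_eq_integral [OF triangle_integrable [OF f]]) (rule AE_I2, rule pos)
  finally show "(\<integral>\<^sup>+ u. \<integral>\<^sup>+ v. (if u < v then ennreal (f u v) else 0) \<partial>unit_interval \<partial>unit_interval) =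
      ennreal (triangle_integral f)" .
  show "0 \<le> triangle_integral f"
    unfolding triangle_integral_def by (rule integral_nonneg_AE) (rule AE_I2, rule pos)
qed

lemma triangle_integral_sum:
  assumes "finite I" "\<And>i. i \<in> I \<Longrightarrow> continuous2 (f i)"
  shows "triangle_integral (\<lambda>u v. \<Sum>i\<in>I. k i * f i u v) = (\<Sum>i\<in>I. k i * triangle_integral (f i))"
proof -
  let ?U = "unit_interval \<Otimes>\<^sub>M unit_interval"
  have "triangle_integral (\<lambda>u v. \<Sum>i\<in>I. k i * f i u v) =
      (\<integral>z. (\<Sum>i\<in>I. k i * (if fst z < snd z then f i (fst z) (snd z) else 0)) \<partial>?U)"
    unfolding triangle_integral_def by (intro Bochner_Integration.integral_cong) auto
  also have "\<dots> = (\<Sum>i\<in>I. \<integral>z. k i * (if fst z < snd z then f i (fst z) (snd z) else 0) \<partial>?U)"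
    by (intro Bochner_Integration.integral_sum integrable_mult_right triangle_integrable assms(2))
  also have "\<dots> = (\<Sum>i\<in>I. k i * triangle_integral (f i))"
    unfolding triangle_integral_def
    by (simp only: integral_mult_right_zero)
  finally show ?thesis .
qed

section \<open>Substitution of the quantile function\<close>

context
  fixes law :: "real measure"
  assumes law: "prob_space law" "sets law = sets borel" and atomless: "\<And>x. emeasure law {x} = 0"
begin

lemma cdf_distribution_law: "cdf_distribution law"
  unfolding cdf_distribution_def by (rule real_distribution_law) (fact law atomless)+

interpretation law: cdf_distribution law
  by (rule cdf_distribution_law)

lemma quantile_le_iff:
  assumes "0 < u" "u < 1"
  shows "law.I u \<le> x \<longleftrightarrow> u \<le> cdf law x"
  by (rule law.pseudoinverse [OF assms, symmetric])

text \<open>The inequality \<open>u \<le> cdf law (law.I u)\<close> follows from the Galois property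
  of the quantile. For the converse, the distribution function stays below \<open>u\<close> to the
  left of \<open>law.I u\<close>, and without an atom it cannot jump there.\<close>

lemma cdf_quantile:
  assumes "0 < u" "u < 1"
  shows "cdf law (law.I u) = u"
proof (rule antisym)
  show "u \<le> cdf law (law.I u)"
    by (rule quantile_le_iff [OF assms, THEN iffD1]) (rule order_refl)
  have "isCont (cdf law) x" for x
    using atomless by (simp add: law.isCont_cdf measure_def)
  then have "(cdf law \<longlongrightarrow> cdf law x) (at_left x)" for x
    unfolding isCont_def filterlim_at_split by metis
  then have "(cdf law \<longlongrightarrow> cdf law (law.I u)) (at_left (law.I u))" .
  moreover have "\<forall>\<^sub>F x in at_left (law.I u). cdf law x \<le> u"
  proof (rule eventually_at_leftI [of "law.I u - 1"])
    fix x assume "x \<in> {law.I u - 1<..<law.I u}"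
    then have "\<not> law.I u \<le> x"
      by (simp only: greaterThanLessThan_iff not_le)
    then have "\<not> u \<le> cdf law x"
      unfolding quantile_le_iff [OF assms] .
    then show "cdf law x \<le> u"
      by linarith
  qed linarith
  ultimately show "cdf law (law.I u) \<le> u"
    by (rule tendsto_upperbound) simp
qed

lemma quantile_less_iff:
  assumes "0 < u" "u < 1" "0 < v" "v < 1"
  shows "law.I u < law.I v \<longleftrightarrow> u < v"
  unfolding not_le [symmetric] quantile_le_iff [OF assms(3,4)] cdf_quantile [OF assms(1,2)] ..

lemma nn_integral_quantile:
  assumes "g \<in> borel_measurable borel"
  shows "(\<integral>\<^sup>+ s. g s \<partial>law) = (\<integral>\<^sup>+ u. g (law.I u) \<partial>unit_interval)"
proof -
  have "sets unit_interval = sets (restrict_space borel {0<..<1})"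
    by (simp add: sets_restrict_space)
  then have "borel_measurable unit_interval = borel_measurable (restrict_space borel {0<..<1})"
    by (rule measurable_cong_sets) (rule refl)
  then have "law.I \<in> borel_measurable unit_interval"
    by (rule ssubst) (rule law.measurable_CI)
  then have "(\<integral>\<^sup>+ s. g s \<partial>distr unit_interval borel law.I) = (\<integral>\<^sup>+ u. g (law.I u) \<partial>unit_interval)"
    by (rule nn_integral_distr) (simp only: measurable_distr_eq1 assms)
  then show ?thesis
    unfolding law.distr_I_eq_M .
qed

text \<open>The integrand depends on \<open>s\<close> and \<open>t\<close> only through their order
  and their distribution function values, and quantiles turn both into those of \<open>u\<close> and
  \<open>v\<close>; thus the law drops out.\<close>

lemma nn_integral_cdf_eq_triangle:
  assumes f: "continuous2 f"
  shows "(\<integral>\<^sup>+ s. \<integral>\<^sup>+ t. (if s < t then ennreal (f (cdf law s) (cdf law t)) else 0) \<partial>law \<partial>law) =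
    (\<integral>\<^sup>+ u. \<integral>\<^sup>+ v. (if u < v then ennreal (f u v) else 0) \<partial>unit_interval \<partial>unit_interval)"
proof -
  let ?g = "\<lambda>s t. if s < t then ennreal (f (cdf law s) (cdf law t)) else 0"
  have [measurable]: "cdf law \<in> borel_measurable borel"
    by (rule law.measurable_C)
  have [measurable]: "(\<lambda>z. f (cdf law (fst z)) (cdf law (snd z))) \<in> borel_measurable (borel \<Otimes>\<^sub>M borel)"
    by (rule continuous2_measurable [OF f]) measurable
  have pair: "(\<lambda>z. ?g (fst z) (snd z)) \<in> borel_measurable (borel \<Otimes>\<^sub>M borel)"
    by measurable
  then have pair': "(\<lambda>(s, t). ?g s t) \<in> borel_measurable (borel \<Otimes>\<^sub>M law)"
    using measurable_cong_sets [OF sets_pair_measure_cong [OF refl law(2)] refl] by (simp add: case_prod_unfold)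
  have inner: "(\<lambda>t. ?g s t) \<in> borel_measurable borel" for s
  proof -
    have [measurable]: "(\<lambda>t. f (cdf law s) (cdf law t)) \<in> borel_measurable borel"
      by (rule continuous2_measurable [OF f]) measurable
    show ?thesis
      by measurable
  qed
  have outer: "(\<lambda>s. \<integral>\<^sup>+ t. ?g s t \<partial>law) \<in> borel_measurable borel"
    using law.borel_measurable_nn_integral [OF pair'] .
  have "(\<integral>\<^sup>+ s. \<integral>\<^sup>+ t. ?g s t \<partial>law \<partial>law) = (\<integral>\<^sup>+ u. \<integral>\<^sup>+ v. ?g (law.I u) (law.I v) \<partial>unit_interval \<partial>unit_interval)"
    by (subst nn_integral_quantile [OF outer]) (simp only: nn_integral_quantile [OF inner])
  also have "\<dots> = (\<integral>\<^sup>+ u. \<integral>\<^sup>+ v. (if u < v then ennreal (f u v) else 0) \<partial>unit_interval \<partial>unit_interval)"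
  proof (intro nn_integral_cong)
    fix u v assume "u \<in> space unit_interval" "v \<in> space unit_interval"
    then have uv: "0 < u" "u < 1" "0 < v" "v < 1"
      by (auto simp: space_restrict_space)
    show "?g (law.I u) (law.I v) = (if u < v then ennreal (f u v) else 0)"
      unfolding quantile_less_iff [OF uv] cdf_quantile [OF uv(1,2)] cdf_quantile [OF uv(3,4)] ..
  qed
  finally show ?thesis .
qed

end

lemma level_prob_nonneg: "0 \<le> u \<Longrightarrow> u \<le> v \<Longrightarrow> v \<le> 1 \<Longrightarrow> 0 \<le> level_prob u v k"
  by (simp add: level_prob_def)

lemma pattern_prob_nonneg: "0 \<le> u \<Longrightarrow> u \<le> v \<Longrightarrow> v \<le> 1 \<Longrightarrow> 0 \<le> pattern_prob K u v"
  unfolding pattern_prob_def by (intro sum_nonneg) (simp add: level_prob_nonneg)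

lemma continuous2_level_prob: "continuous_on UNIV (\<lambda>z. level_prob (fst z) (snd z) k)"
  unfolding level_prob_def by (cases "k = 0"; cases "k = 1") (auto intro!: continuous_intros)

lemma continuous2_pattern_prob: "continuous2 (\<lambda>u v. pattern_prob K u v ^ h)"
proof -
  have "continuous_on UNIV (\<lambda>z. if K p q r s then level_prob (fst z) (snd z) p * level_prob (fst z) (snd z) q *
      level_prob (fst z) (snd z) r * level_prob (fst z) (snd z) s else 0)" for p q r s
    by (cases "K p q r s") (auto intro!: continuous_intros continuous2_level_prob)
  then show ?thesis
    unfolding continuous2_def pattern_prob_def by (intro continuous_on_power continuous_on_sum)
qed

section \<open>Transfer from the random weights to triangle integrals\<close>

locale hub_weights = iid_atomless_weights M "G_edges h" W law
  for M :: "'w measure" and h W law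
begin

lemma measurable_weight [measurable]: "e \<in> G_edges h \<Longrightarrow> W e \<in> borel_measurable M"
  using indep_weights by (simp add: indep_vars_def)

lemma edge_A_mem: "edge_A \<in> G_edges h"
  by (simp add: G_edges_eq)

lemma finite_G_edges: "finite (G_edges h)"
  by (simp add: G_edges_eq finite_hub_edges)

lemma sets_law: "sets law = sets borel"
  using weight_law [OF edge_A_mem] by (metis sets_distr)

lemma prob_space_law: "prob_space law"
  using weight_law [OF edge_A_mem] prob_space_distr [OF measurable_weight [OF edge_A_mem]] by simp

lemma distr_weights:
  "distr M (PiM (G_edges h) (\<lambda>_. law)) (\<lambda>\<omega>. \<lambda>e\<in>G_edges h. W e \<omega>) = PiM (G_edges h) (\<lambda>_. law)"
proof -
  have "distr M (PiM (G_edges h) (\<lambda>_. borel)) (\<lambda>\<omega>. \<lambda>e\<in>G_edges h. W e \<omega>) =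
      PiM (G_edges h) (\<lambda>e. distr M borel (W e))"
  proof (rule indep_vars_iff_distr_eq_PiM' [THEN iffD1])
    show "G_edges h \<noteq> {}"
      using edge_A_mem by (metis empty_iff)
    show "W e \<in> borel_measurable M" if "e \<in> G_edges h" for e
      by (rule measurable_weight [OF that])
  qed (rule indep_weights)
  also have "\<dots> = PiM (G_edges h) (\<lambda>_. law)"
    by (intro PiM_cong refl weight_law)
  also have "distr M (PiM (G_edges h) (\<lambda>_. borel)) (\<lambda>\<omega>. \<lambda>e\<in>G_edges h. W e \<omega>) =
      distr M (PiM (G_edges h) (\<lambda>_. law)) (\<lambda>\<omega>. \<lambda>e\<in>G_edges h. W e \<omega>)"
    by (intro distr_cong refl sets_PiM_cong) (simp add: sets_law)
  finally show ?thesis .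
qed

lemma measurable_weights:
  "(\<lambda>\<omega>. \<lambda>e\<in>G_edges h. W e \<omega>) \<in> measurable M (PiM (G_edges h) (\<lambda>_. law))"
proof (rule measurable_restrict)
  fix e assume "e \<in> G_edges h"
  then show "W e \<in> measurable M law"
    by (subst measurable_cong_sets [OF refl sets_law]) (rule measurable_weight)
qed

lemma pattern_event_restrict:
  assumes "roles a b c d"
  shows "pattern_event h a b c d K (\<lambda>e\<in>G_edges h. x e) \<longleftrightarrow> pattern_event h a b c d K x"
proof -
  have AB: "{a, b} \<in> G_edges h" "{c, d} \<in> G_edges h"
    by (simp_all add: rolesD(3) [OF assms])
  have hub: "{Hub i, y} \<in> G_edges h" if "i < h" "y \<in> {a, b, c, d}" for i y
  proof -
    have "{Hub i, y} \<in> hub_edges h"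
      using that rolesD(1) [OF assms] unfolding hub_edges_def by (intro image_eqI [of _ _ "(i, y)"]) simp_all
    then show ?thesis
      by (simp add: rolesD(3) [OF assms])
  qed
  have "hub_pattern a b c d K s t (\<lambda>e\<in>G_edges h. x e) i \<longleftrightarrow> hub_pattern a b c d K s t x i"
    if "i \<in> {..<h}" for s t i
    using that hub by (simp add: hub_pattern_def)
  then show ?thesis
    unfolding pattern_event_def by (simp only: restrict_apply AB if_True cong: ball_cong)
qed

lemma pattern_set_eq:
  assumes "roles a b c d"
  shows "{\<omega> \<in> space M. pattern_event h a b c d K (\<lambda>e. W e \<omega>)} =
    (\<lambda>\<omega>. \<lambda>e\<in>G_edges h. W e \<omega>) -` {x \<in> space (PiM (G_edges h) (\<lambda>_. law)). pattern_event h a b c d K x} \<inter> space M"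
  using measurable_space [OF measurable_weights] pattern_event_restrict [OF assms, of K "\<lambda>e. W e _"] by auto

lemma pattern_sets_PiM:
  assumes "roles a b c d"
  shows "{x \<in> space (PiM (G_edges h) (\<lambda>_. law)). pattern_event h a b c d K x} \<in> sets (PiM (G_edges h) (\<lambda>_. law))"
  using measurable_pattern_event [OF prob_space_law sets_law atomless assms, of h K] by (simp add: pred_def)

lemma pattern_set_measurable:
  assumes "roles a b c d"
  shows "{\<omega> \<in> space M. pattern_event h a b c d K (\<lambda>e. W e \<omega>)} \<in> sets M"
  unfolding pattern_set_eq [OF assms]
  by (rule measurable_sets [OF measurable_weights pattern_sets_PiM [OF assms]])

lemma measure_pattern:
  assumes roles: "roles a b c d"
  shows "measure M {\<omega> \<in> space M. pattern_event h a b c d K (\<lambda>e. W e \<omega>)} =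
    triangle_integral (\<lambda>u v. pattern_prob K u v ^ h)"
proof -
  let ?P = "PiM (G_edges h) (\<lambda>_. law)"
  let ?S = "{x \<in> space ?P. pattern_event h a b c d K x}"
  have nonneg: "0 \<le> pattern_prob K u v ^ h" if "0 < u" "u < v" "v < 1" for u v
    using that by (intro zero_le_power pattern_prob_nonneg) simp_all
  have "emeasure M {\<omega> \<in> space M. pattern_event h a b c d K (\<lambda>e. W e \<omega>)} =
      emeasure (distr M ?P (\<lambda>\<omega>. \<lambda>e\<in>G_edges h. W e \<omega>)) ?S"
    unfolding pattern_set_eq [OF roles]
    by (rule emeasure_distr [OF measurable_weights pattern_sets_PiM [OF roles], symmetric])
  also have "\<dots> = emeasure ?P ?S"
    unfolding distr_weights ..
  also have "\<dots> = ennreal (triangle_integral (\<lambda>u v. pattern_prob K u v ^ h))"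
    unfolding emeasure_pattern_event [OF prob_space_law sets_law atomless roles]
      nn_integral_cdf_eq_triangle [OF prob_space_law sets_law atomless continuous2_pattern_prob]
    by (rule nn_triangle_integral(1) [OF continuous2_pattern_prob nonneg])
  finally show ?thesis
    using nn_triangle_integral(2) [OF continuous2_pattern_prob nonneg] by (simp add: measure_def)
qed

text \<open>The diagonal is a null set of \<open>law \<Otimes>\<^sub>M law\<close>, as each of its
  sections is a single point; only finitely many pairs of edges occur.\<close>

lemma AE_distinct_weights: "AE \<omega> in M. inj_on (\<lambda>e. W e \<omega>) (G_edges h)"
proof -
  interpret law: prob_space law
    by (rule prob_space_law)
  have *: "AE \<omega> in M. W e \<omega> \<noteq> W e' \<omega>" if e: "e \<in> G_edges h" "e' \<in> G_edges h" "e \<noteq> e'" for e e'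
  proof -
    have "indep_vars (\<lambda>_. borel) W (insert e {e'})"
      by (rule indep_vars_subset [OF indep_weights]) (use e in auto)
    \<comment> \<open>The sum over the singleton \<open>{e'}\<close> is \<open>W e'\<close>, which
      turns independence of a family into independence of a pair.\<close>
    then have "indep_var borel (W e) borel (W e')"
      using indep_vars_sum [of "{e'}" e W] e(3) by simp
    then have "distr M borel (W e) \<Otimes>\<^sub>M distr M borel (W e') = distr M (borel \<Otimes>\<^sub>M borel) (\<lambda>\<omega>. (W e \<omega>, W e' \<omega>))"
      by (simp add: indep_var_distribution_eq)
    then have D: "law \<Otimes>\<^sub>M law = distr M (borel \<Otimes>\<^sub>M borel) (\<lambda>\<omega>. (W e \<omega>, W e' \<omega>))"
      using weight_law e(1,2) by metis
    let ?D = "{z :: real \<times> real. fst z = snd z}"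
    have "closed ?D"
      by (intro closed_Collect_eq continuous_intros)
    then have borel: "?D \<in> sets (borel \<Otimes>\<^sub>M borel)"
      unfolding borel_prod by (rule borel_closed)
    then have meas: "?D \<in> sets (law \<Otimes>\<^sub>M law)"
      unfolding sets_pair_measure_cong [OF sets_law sets_law] .
    have "Pair x -` ?D = {x}" for x
      by auto
    then have "emeasure (law \<Otimes>\<^sub>M law) ?D = 0"
      unfolding law.emeasure_pair_measure_alt [OF meas] by (simp add: atomless)
    then have "AE z in law \<Otimes>\<^sub>M law. fst z \<noteq> snd z"
      using meas by (intro AE_I [of _ _ ?D]) auto
    moreover have "(\<lambda>\<omega>. (W e \<omega>, W e' \<omega>)) \<in> measurable M (borel \<Otimes>\<^sub>M borel)"
      using e(1,2) by measurable
    moreover have "{z \<in> space (borel \<Otimes>\<^sub>M borel). fst z \<noteq> snd z} \<in> sets (borel \<Otimes>\<^sub>M (borel :: real measure))"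
      using sets.compl_sets [OF borel] by (simp add: set_diff_eq)
    ultimately show ?thesis
      unfolding D by (subst (asm) AE_distr_iff) simp_all
  qed
  have "AE \<omega> in M. \<forall>p\<in>G_edges h \<times> G_edges h. fst p \<noteq> snd p \<longrightarrow> W (fst p) \<omega> \<noteq> W (snd p) \<omega>"
  proof (intro AE_finite_allI finite_cartesian_product finite_G_edges)
    fix p assume "p \<in> G_edges h \<times> G_edges h"
    then have "AE \<omega> in M. W (fst p) \<omega> \<noteq> W (snd p) \<omega>" if "fst p \<noteq> snd p"
      using that * by (metis mem_Times_iff)
    then show "AE \<omega> in M. fst p \<noteq> snd p \<longrightarrow> W (fst p) \<omega> \<noteq> W (snd p) \<omega>"
      by (cases "fst p = snd p") simp_all
  qed
  then show ?thesis
    by eventually_elim (force simp: inj_on_def)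
qed

end

section \<open>Inclusion and exclusion over the cuts\<close>

lemma (in finite_measure) measure_Un_eq:
  assumes "A \<in> sets M" "B \<in> sets M"
  shows "measure M (A \<union> B) = measure M A + measure M B - measure M (A \<inter> B)"
  using finite_measure_Union' [OF assms] finite_measure_Diff' [OF assms(2,1)]
  by (simp add: Int_commute)

lemma (in finite_measure) measure_Un4:
  assumes "A \<in> sets M" "B \<in> sets M" "C \<in> sets M" "D \<in> sets M"
  shows "measure M (A \<union> B \<union> C \<union> D) = measure M A + measure M B + measure M C + measure M D
    - (measure M (A \<inter> B) + measure M (A \<inter> C) + measure M (A \<inter> D) +
       measure M (B \<inter> C) + measure M (B \<inter> D) + measure M (C \<inter> D))
    + (measure M (A \<inter> B \<inter> C) + measure M (A \<inter> B \<inter> D) + measure M (A \<inter> C \<inter> D) + measure M (B \<inter> C \<inter> D))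
    - measure M (A \<inter> B \<inter> C \<inter> D)"
proof -
  have three: "measure M (X \<union> Y \<union> Z) = measure M X + measure M Y + measure M Z
      - measure M (X \<inter> Y) - measure M (X \<inter> Z) - measure M (Y \<inter> Z) + measure M (X \<inter> Y \<inter> Z)"
    if "X \<in> sets M" "Y \<in> sets M" "Z \<in> sets M" for X Y Z
  proof -
    have "(X \<inter> Z) \<inter> (Y \<inter> Z) = X \<inter> Y \<inter> Z"
      by auto
    then show ?thesis
      using that by (simp add: measure_Un_eq Int_Un_distrib2)
  qed
  have "(A \<inter> D) \<inter> (B \<inter> D) = A \<inter> B \<inter> D" "(A \<inter> D) \<inter> (C \<inter> D) = A \<inter> C \<inter> D"
    "(B \<inter> D) \<inter> (C \<inter> D) = B \<inter> C \<inter> D" "(A \<inter> B \<inter> D) \<inter> (C \<inter> D) = A \<inter> B \<inter> C \<inter> D"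
    by auto
  moreover have "measure M (A \<union> B \<union> C \<union> D) =
      measure M (A \<union> B \<union> C) + measure M D - measure M ((A \<inter> D) \<union> (B \<inter> D) \<union> (C \<inter> D))"
    using assms by (simp add: measure_Un_eq [of "A \<union> B \<union> C"] Int_Un_distrib2)
  ultimately show ?thesis
    using assms by (simp add: three)
qed

text \<open>The arguments are the levels of the edges from a hub to \<open>a\<close>, \<open>b\<close>, \<open>c\<close>, \<open>d\<close>. The cuts \<open>cut_a\<close>, \<open>cut_b\<close>,
  \<open>cut_ac\<close> and \<open>cut_ad\<close> separate \<open>a\<close> from \<open>b\<close> at the weight of the lighter edge \<open>{a, b}\<close>; \<open>cut_c\<close> and
  \<open>cut_d\<close> separate \<open>c\<close> from \<open>d\<close>, but not \<open>a\<close> from \<open>b\<close>, at the weight of the heavier edge \<open>{c, d}\<close>.\<close>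

definition "cut_a p q r s \<longleftrightarrow> cut1 (p = 0) (q = 0) (r = 0) (s = (0::nat))"
  for p q r :: nat
definition "cut_b p q r s \<longleftrightarrow> cut1 (q = 0) (p = 0) (r = 0) (s = (0::nat))"
  for p q r :: nat
definition "cut_ac p q r s \<longleftrightarrow> cut2 (p = 0) (r = 0) (q = 0) (s = (0::nat))"
  for p q r :: nat
definition "cut_ad p q r s \<longleftrightarrow> cut2 (p = 0) (s = 0) (q = 0) (r = (0::nat))"
  for p q s :: nat
definition "cut_c p q r s \<longleftrightarrow> cut1 (r < 2) (p < 2) (q < 2) (s < (2::nat))"
  for p q r :: nat
definition "cut_d p q r s \<longleftrightarrow> cut1 (s < 2) (p < 2) (q < 2) (r < (2::nat))"
  for p q s :: nat

lemmas cut_defs = cut_a_def cut_b_def cut_ac_def cut_ad_def cut_c_def cut_d_def cut1_def cut2_def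

abbreviation both :: "pattern \<Rightarrow> pattern \<Rightarrow> pattern" (infixl "\<sqdot>" 65) where
  "K \<sqdot> K' \<equiv> \<lambda>p q r s. K p q r s \<and> K' p q r s"

lemma sum_lessThan_3: "(\<Sum>p<3. f p) = f 0 + f 1 + f (2::nat)" for f :: "nat \<Rightarrow> real"
  by (simp add: numeral_3_eq_3 numeral_2_eq_2)

text \<open>This is \<open>1 - u * (1 - (1 - u)^3)\<close>: the cut is violated when the isolated
  edge and one of the other three are light. The digits in this name and the next three are block
  sizes of the common refinement.\<close>

lemma pattern_prob_13:
  "pattern_prob (cut_a) u v = 1 - 3 * u^2 + 3 * u^3 - u^4"
  "pattern_prob (cut_b) u v = 1 - 3 * u^2 + 3 * u^3 - u^4"
  unfolding pattern_prob_def sum_lessThan_3 level_prob_def cut_defs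
  by (simp, algebra)+

text \<open>This is \<open>1 - (1 - (1 - u)^2)^2\<close>, since a violation needs a light edge on
  each side.\<close>

lemma pattern_prob_22:
  "pattern_prob (cut_ac) u v = 1 - 4 * u^2 + 4 * u^3 - u^4"
  "pattern_prob (cut_ad) u v = 1 - 4 * u^2 + 4 * u^3 - u^4"
  unfolding pattern_prob_def sum_lessThan_3 level_prob_def cut_defs
  by (simp, algebra)+

text \<open>Either at most one edge is light, or exactly the two edges into the block of size two
  are.\<close>

lemma pattern_prob_211:
  "pattern_prob (cut_a \<sqdot> cut_ac) u v = 1 - 5 * u^2 + 6 * u^3 - 2 * u^4"
  "pattern_prob (cut_a \<sqdot> cut_ad) u v = 1 - 5 * u^2 + 6 * u^3 - 2 * u^4"
  "pattern_prob (cut_a \<sqdot> cut_b) u v = 1 - 5 * u^2 + 6 * u^3 - 2 * u^4"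
  "pattern_prob (cut_ac \<sqdot> cut_b) u v = 1 - 5 * u^2 + 6 * u^3 - 2 * u^4"
  "pattern_prob (cut_ad \<sqdot> cut_b) u v = 1 - 5 * u^2 + 6 * u^3 - 2 * u^4"
  unfolding pattern_prob_def sum_lessThan_3 level_prob_def cut_defs
  by (simp, algebra)+

text \<open>The two balanced cuts, or any three of the four cuts, already separate all terminals, so
  at most one edge is light: \<open>(1 - u)^3 * (1 + 3 * u)\<close>.\<close>

lemma pattern_prob_1111:
  "pattern_prob (cut_ac \<sqdot> cut_ad) u v = 1 - 6 * u^2 + 8 * u^3 - 3 * u^4"
  "pattern_prob (cut_a \<sqdot> cut_ac \<sqdot> cut_ad) u v = 1 - 6 * u^2 + 8 * u^3 - 3 * u^4"
  "pattern_prob (cut_a \<sqdot> cut_ac \<sqdot> cut_b) u v = 1 - 6 * u^2 + 8 * u^3 - 3 * u^4"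
  "pattern_prob (cut_a \<sqdot> cut_ad \<sqdot> cut_b) u v = 1 - 6 * u^2 + 8 * u^3 - 3 * u^4"
  "pattern_prob (cut_ac \<sqdot> cut_ad \<sqdot> cut_b) u v = 1 - 6 * u^2 + 8 * u^3 - 3 * u^4"
  "pattern_prob (cut_a \<sqdot> cut_ac \<sqdot> cut_ad \<sqdot> cut_b) u v = 1 - 6 * u^2 + 8 * u^3 - 3 * u^4"
  unfolding pattern_prob_def sum_lessThan_3 level_prob_def cut_defs
  by (simp, algebra)+

text \<open>Either the edge to the isolated terminal is at level 2, or it is below and the other
  three are at level 2: \<open>(1 - v) + v * (1 - v)^3\<close>.\<close>

lemma pattern_prob_heavier:
  "pattern_prob (cut_c) u v = (1 - v) * (1 + v * (1 - v)^2)"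
  "pattern_prob (cut_d) u v = (1 - v) * (1 + v * (1 - v)^2)"
  unfolding pattern_prob_def sum_lessThan_3 level_prob_def cut_defs
  by (simp, algebra)+

lemma pattern_prob_heavier_both:
  "pattern_prob (cut_c \<sqdot> cut_d) u v = (1 - v)^2 * (1 + 2 * v * (1 - v))"
  unfolding pattern_prob_def sum_lessThan_3 level_prob_def cut_defs
  by (simp, algebra)+

text \<open>If the terminal isolated by the heavier cut has level 2, the lighter cut acts on the
  other three with probability \<open>1 - u * (1 - (1 - u)^2)\<close>. Otherwise those three have
  level 2 and the lighter cut is respected automatically.\<close>

lemma pattern_prob_joint:
  "pattern_prob ((cut_a \<sqdot> cut_c)) u v = (1 - v) * (1 - 2 * u^2 + u^3 + v * (1 - v)^2)"
  "pattern_prob ((cut_ad \<sqdot> cut_c)) u v = (1 - v) * (1 - 2 * u^2 + u^3 + v * (1 - v)^2)"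
  "pattern_prob ((cut_a \<sqdot> cut_d)) u v = (1 - v) * (1 - 2 * u^2 + u^3 + v * (1 - v)^2)"
  "pattern_prob ((cut_ac \<sqdot> cut_d)) u v = (1 - v) * (1 - 2 * u^2 + u^3 + v * (1 - v)^2)"
  unfolding pattern_prob_def sum_lessThan_3 level_prob_def cut_defs
  by (simp, algebra)+

text \<open>The two lighter cuts together separate the three remaining terminals, of which at most
  one may have level 0: \<open>(1 - u)^2 * (1 + 2 * u)\<close>.\<close>

lemma pattern_prob_joint_same:
  "pattern_prob ((cut_a \<sqdot> cut_c) \<sqdot> (cut_ad \<sqdot> cut_c)) u v = (1 - v) * (1 - 3 * u^2 + 2 * u^3 + v * (1 - v)^2)"
  "pattern_prob ((cut_a \<sqdot> cut_d) \<sqdot> (cut_ac \<sqdot> cut_d)) u v = (1 - v) * (1 - 3 * u^2 + 2 * u^3 + v * (1 - v)^2)"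
  unfolding pattern_prob_def sum_lessThan_3 level_prob_def cut_defs
  by (simp, algebra)+

text \<open>With both heavier cuts present, either \<open>c\<close> and \<open>d\<close> have level
  2 and \<open>a\<close>, \<open>b\<close> are not both at level 0, or exactly one of
  \<open>c\<close>, \<open>d\<close> is below level 2 and the other three terminals are at level
  2.\<close>

lemma pattern_prob_joint_cross:
  "pattern_prob ((cut_a \<sqdot> cut_c) \<sqdot> (cut_a \<sqdot> cut_d)) u v = (1 - v)^2 * (1 - u^2 + 2 * v * (1 - v))"
  "pattern_prob ((cut_a \<sqdot> cut_c) \<sqdot> (cut_ac \<sqdot> cut_d)) u v = (1 - v)^2 * (1 - u^2 + 2 * v * (1 - v))"
  "pattern_prob ((cut_ad \<sqdot> cut_c) \<sqdot> (cut_a \<sqdot> cut_d)) u v = (1 - v)^2 * (1 - u^2 + 2 * v * (1 - v))"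
  "pattern_prob ((cut_ad \<sqdot> cut_c) \<sqdot> (cut_ac \<sqdot> cut_d)) u v = (1 - v)^2 * (1 - u^2 + 2 * v * (1 - v))"
  "pattern_prob ((cut_a \<sqdot> cut_c) \<sqdot> (cut_ad \<sqdot> cut_c) \<sqdot> (cut_a \<sqdot> cut_d)) u v = (1 - v)^2 * (1 - u^2 + 2 * v * (1 - v))"
  "pattern_prob ((cut_a \<sqdot> cut_c) \<sqdot> (cut_ad \<sqdot> cut_c) \<sqdot> (cut_ac \<sqdot> cut_d)) u v = (1 - v)^2 * (1 - u^2 + 2 * v * (1 - v))"
  "pattern_prob ((cut_a \<sqdot> cut_c) \<sqdot> (cut_a \<sqdot> cut_d) \<sqdot> (cut_ac \<sqdot> cut_d)) u v = (1 - v)^2 * (1 - u^2 + 2 * v * (1 - v))"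
  "pattern_prob ((cut_ad \<sqdot> cut_c) \<sqdot> (cut_a \<sqdot> cut_d) \<sqdot> (cut_ac \<sqdot> cut_d)) u v = (1 - v)^2 * (1 - u^2 + 2 * v * (1 - v))"
  "pattern_prob ((cut_a \<sqdot> cut_c) \<sqdot> (cut_ad \<sqdot> cut_c) \<sqdot> (cut_a \<sqdot> cut_d) \<sqdot> (cut_ac \<sqdot> cut_d)) u v = (1 - v)^2 * (1 - u^2 + 2 * v * (1 - v))"
  unfolding pattern_prob_def sum_lessThan_3 level_prob_def cut_defs
  by (simp, algebra)+

section \<open>The three probabilities as combinations of power integrals\<close>

context hub_weights
begin

definition pattern_set :: "vertex \<Rightarrow> vertex \<Rightarrow> vertex \<Rightarrow> vertex \<Rightarrow> pattern \<Rightarrow> 'w set" where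
  "pattern_set a b c d K = {\<omega> \<in> space M. pattern_event h a b c d K (\<lambda>e. W e \<omega>)}"

lemma sets_pattern_set: "roles a b c d \<Longrightarrow> pattern_set a b c d K \<in> sets M"
  unfolding pattern_set_def by (rule pattern_set_measurable)

lemma measure_pattern_set:
  "roles a b c d \<Longrightarrow> measure M (pattern_set a b c d K) = triangle_integral (\<lambda>u v. pattern_prob K u v ^ h)"
  unfolding pattern_set_def by (rule measure_pattern)

lemma pattern_set_Int: "pattern_set a b c d K \<inter> pattern_set a b c d K' = pattern_set a b c d (K \<sqdot> K')"
  by (auto simp: pattern_set_def pattern_event_def hub_pattern_def)

abbreviation power_integral :: "(real \<Rightarrow> real \<Rightarrow> real) \<Rightarrow> real" where
  "power_integral f \<equiv> triangle_integral (\<lambda>u v. f u v ^ h)"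

text \<open>Coefficients of the inclusion-exclusion: five of the six pairs have block sizes 2, 1, 1.
  The sixth pair, the four triples and the quadruple separate everything and contribute -1 + 4 - 1 =
  2.\<close>

definition lighter_prob :: real where
  "lighter_prob = 2 * power_integral (\<lambda>u v. 1 - 3 * u^2 + 3 * u^3 - u^4)
    + 2 * power_integral (\<lambda>u v. 1 - 4 * u^2 + 4 * u^3 - u^4)
    - 5 * power_integral (\<lambda>u v. 1 - 5 * u^2 + 6 * u^3 - 2 * u^4)
    + 2 * power_integral (\<lambda>u v. 1 - 6 * u^2 + 8 * u^3 - 3 * u^4)"

definition heavier_prob :: real where
  "heavier_prob = 2 * power_integral (\<lambda>u v. (1 - v) * (1 + v * (1 - v)^2))
    - power_integral (\<lambda>u v. (1 - v)^2 * (1 + 2 * v * (1 - v)))"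

text \<open>Two of the six pairs share the heavier cut. The other four pairs, the four triples and
  the quadruple give the same integral, with total coefficient -4 + 4 - 1 = -1.\<close>

definition joint_prob :: real where
  "joint_prob = 4 * power_integral (\<lambda>u v. (1 - v) * (1 - 2 * u^2 + u^3 + v * (1 - v)^2))
    - 2 * power_integral (\<lambda>u v. (1 - v) * (1 - 3 * u^2 + 2 * u^3 + v * (1 - v)^2))
    - power_integral (\<lambda>u v. (1 - v)^2 * (1 - u^2 + 2 * v * (1 - v)))"

lemma measure_lighter:
  assumes "roles a b c d"
  shows "measure M (pattern_set a b c d cut_a \<union> pattern_set a b c d cut_ac \<union>
    pattern_set a b c d cut_ad \<union> pattern_set a b c d cut_b) = lighter_prob"
  unfolding measure_Un4 [OF sets_pattern_set sets_pattern_set sets_pattern_set sets_pattern_set, OF assms assms assms assms]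
    pattern_set_Int measure_pattern_set [OF assms]
    pattern_prob_13 pattern_prob_22 pattern_prob_211 pattern_prob_1111 lighter_prob_def
  by simp

lemma measure_heavier:
  assumes "roles a b c d"
  shows "measure M (pattern_set a b c d cut_c \<union> pattern_set a b c d cut_d) = heavier_prob"
  unfolding measure_Un_eq [OF sets_pattern_set sets_pattern_set, OF assms assms]
    pattern_set_Int measure_pattern_set [OF assms]
    pattern_prob_heavier pattern_prob_heavier_both heavier_prob_def
  by simp

lemma joint_pattern_set:
  "(pattern_set a b c d cut_a \<union> pattern_set a b c d cut_ac \<union> pattern_set a b c d cut_ad \<union> pattern_set a b c d cut_b) \<inter>
    (pattern_set a b c d cut_c \<union> pattern_set a b c d cut_d) =
   pattern_set a b c d (cut_a \<sqdot> cut_c) \<union> pattern_set a b c d (cut_ad \<sqdot> cut_c) \<union>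
    pattern_set a b c d (cut_a \<sqdot> cut_d) \<union> pattern_set a b c d (cut_ac \<sqdot> cut_d)"
proof -
  \<comment> \<open>At a hub that respects the heavier cut around \<open>c\<close>, the lighter cuts around \<open>{a}\<close> and \<open>{a, c}\<close> agree, etc.\<close>
  have "cut_ac \<sqdot> cut_c = cut_a \<sqdot> cut_c" "cut_b \<sqdot> cut_c = cut_ad \<sqdot> cut_c"
    "cut_ad \<sqdot> cut_d = cut_a \<sqdot> cut_d" "cut_b \<sqdot> cut_d = cut_ac \<sqdot> cut_d"
    by (auto simp: fun_eq_iff cut_defs)
  then show ?thesis
    by (simp only: Int_Un_distrib Int_Un_distrib2 pattern_set_Int Un_ac Un_absorb Un_left_absorb)
qed

lemma measure_joint:
  assumes "roles a b c d"
  shows "measure M ((pattern_set a b c d cut_a \<union> pattern_set a b c d cut_ac \<union>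
      pattern_set a b c d cut_ad \<union> pattern_set a b c d cut_b) \<inter>
    (pattern_set a b c d cut_c \<union> pattern_set a b c d cut_d)) = joint_prob"
  unfolding joint_pattern_set
    measure_Un4 [OF sets_pattern_set sets_pattern_set sets_pattern_set sets_pattern_set, OF assms assms assms assms]
    pattern_set_Int measure_pattern_set [OF assms]
    pattern_prob_joint pattern_prob_joint_same pattern_prob_joint_cross joint_prob_def
  by simp

end

section \<open>The probabilities as integrals\<close>

lemma level_eq_0_iff: "level s t x = 0 \<longleftrightarrow> x < s"
  by (simp add: level_def)

lemma level_less_2_iff: "s < t \<Longrightarrow> level s t x < 2 \<longleftrightarrow> x < t"
  by (simp add: level_def)

text \<open>\<open>R\<close> may be any predicate, because the set it is applied to has only
  finitely many possible values, each taken on a measurable set.\<close>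

lemma sets_Collect_finite_set_of:
  assumes "finite I" and Q: "\<And>F. F \<in> I \<Longrightarrow> {\<omega> \<in> space M. Q F \<omega>} \<in> sets M"
  shows "{\<omega> \<in> space M. R {F \<in> I. Q F \<omega>}} \<in> sets M"
proof -
  have "{\<omega> \<in> space M. R {F \<in> I. Q F \<omega>}} =
      (\<Union>\<F>\<in>{\<F> \<in> Pow I. R \<F>}. {\<omega> \<in> space M. \<forall>F\<in>I. Q F \<omega> \<longleftrightarrow> F \<in> \<F>})" (is "?L = ?R")
  proof (intro set_eqI iffI)
    fix \<omega> assume "\<omega> \<in> ?L"
    then show "\<omega> \<in> ?R"
      by (intro UN_I [of "{F \<in> I. Q F \<omega>}"]) auto
  next
    fix \<omega> assume "\<omega> \<in> ?R"
    then obtain \<F> where "\<F> \<in> {\<F> \<in> Pow I. R \<F>}"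
      "\<omega> \<in> {\<omega> \<in> space M. \<forall>F\<in>I. Q F \<omega> \<longleftrightarrow> F \<in> \<F>}"
      by (rule UN_E)
    then have \<F>: "\<F> \<subseteq> I" "R \<F>" "\<omega> \<in> space M" "\<forall>F\<in>I. Q F \<omega> \<longleftrightarrow> F \<in> \<F>"
      by simp_all
    then have "{F \<in> I. Q F \<omega>} = \<F>"
      by auto
    then show "\<omega> \<in> ?L"
      using \<F> by simp
  qed
  moreover have "{\<omega> \<in> space M. \<forall>F\<in>I. Q F \<omega> \<longleftrightarrow> F \<in> \<F>} \<in> sets M" for \<F>
  proof (rule sets.sets_Collect_finite_All [OF _ \<open>finite I\<close>])
    fix F assume "F \<in> I"
    then show "{\<omega> \<in> space M. Q F \<omega> \<longleftrightarrow> F \<in> \<F>} \<in> sets M"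
      using Q [of F] sets.sets_Collect_neg [of M "Q F"] by (cases "F \<in> \<F>") simp_all
  qed
  ultimately show ?thesis
    using \<open>finite I\<close> by (simp only:) (intro sets.finite_UN, auto)
qed

context hub_weights
begin

definition lighter_set :: "vertex \<Rightarrow> vertex \<Rightarrow> vertex \<Rightarrow> vertex \<Rightarrow> 'w set" where
  "lighter_set a b c d = pattern_set a b c d cut_a \<union> pattern_set a b c d cut_ac \<union>
    pattern_set a b c d cut_ad \<union> pattern_set a b c d cut_b"

definition heavier_set :: "vertex \<Rightarrow> vertex \<Rightarrow> vertex \<Rightarrow> vertex \<Rightarrow> 'w set" where
  "heavier_set a b c d = pattern_set a b c d cut_c \<union> pattern_set a b c d cut_d"

lemma sets_lighter_heavier:
  assumes "roles a b c d"
  shows "lighter_set a b c d \<in> sets M" "heavier_set a b c d \<in> sets M"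
  unfolding lighter_set_def heavier_set_def by (intro sets.Un sets_pattern_set assms)+

lemma mem_pattern_set_iff:
  assumes "\<omega> \<in> space M"
  shows "\<omega> \<in> pattern_set a b c d K \<longleftrightarrow> W {a, b} \<omega> < W {c, d} \<omega> \<and>
    (\<forall>i<h. K (level (W {a, b} \<omega>) (W {c, d} \<omega>) (W {Hub i, a} \<omega>)) (level (W {a, b} \<omega>) (W {c, d} \<omega>) (W {Hub i, b} \<omega>))
      (level (W {a, b} \<omega>) (W {c, d} \<omega>) (W {Hub i, c} \<omega>)) (level (W {a, b} \<omega>) (W {c, d} \<omega>) (W {Hub i, d} \<omega>)))"
  using assms by (simp add: pattern_set_def pattern_event_def hub_pattern_def Ball_def)

lemma lighter_set_iff:
  assumes "1 \<le> h" "roles a b c d" "\<omega> \<in> space M" "inj_on (\<lambda>e. W e \<omega>) (G_edges h)"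
  shows "\<omega> \<in> lighter_set a b c d \<longleftrightarrow> W {a, b} \<omega> < W {c, d} \<omega> \<and> {a, b} \<in> random_mst h W \<omega>"
proof (cases "W {a, b} \<omega> < W {c, d} \<omega>")
  case True
  then show ?thesis
    unfolding random_mst_def lighter_edge_mem_mst_iff [OF assms(1,4,2) True]
    unfolding lighter_set_def Un_iff mem_pattern_set_iff [OF assms(3)]
      cut_a_def cut_b_def cut_ac_def cut_ad_def level_eq_0_iff by simp
next
  case False
  then show ?thesis
    unfolding lighter_set_def Un_iff mem_pattern_set_iff [OF assms(3)] by simp
qed

lemma heavier_set_iff:
  assumes "1 \<le> h" "roles a b c d" "\<omega> \<in> space M" "inj_on (\<lambda>e. W e \<omega>) (G_edges h)"
  shows "\<omega> \<in> heavier_set a b c d \<longleftrightarrow> W {a, b} \<omega> < W {c, d} \<omega> \<and> {c, d} \<in> random_mst h W \<omega>"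
proof (cases "W {a, b} \<omega> < W {c, d} \<omega>")
  case True
  then show ?thesis
    unfolding random_mst_def heavier_edge_mem_mst_iff [OF assms(1,4,2) True]
    unfolding heavier_set_def Un_iff mem_pattern_set_iff [OF assms(3)]
      cut_c_def cut_d_def level_less_2_iff [OF True] by simp
next
  case False
  then show ?thesis
    unfolding heavier_set_def Un_iff mem_pattern_set_iff [OF assms(3)] by simp
qed

text \<open>When weights coincide, the minimum spanning tree may be a junk value, but it still depends only on
  the finite set of minimising trees.\<close>

lemma sets_mst_event: "{\<omega> \<in> space M. R (random_mst h W \<omega>)} \<in> sets M"
proof -
  let ?I = "{F. spanning_tree (G_verts h) (G_edges h) F}"
  let ?Q = "\<lambda>F \<omega>. min_spanning_tree (G_verts h) (G_edges h) (\<lambda>e. W e \<omega>) F"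
  have fin: "finite ?I"
    using finite_G_edges by (rule_tac finite_subset [of _ "Pow (G_edges h)"]) (auto simp: spanning_tree_def)
  have [measurable]: "(\<lambda>\<omega>. \<Sum>e\<in>F. W e \<omega>) \<in> borel_measurable M" if "F \<in> ?I" for F
  proof (rule borel_measurable_sum)
    fix e assume "e \<in> F"
    then show "W e \<in> borel_measurable M"
      using that by (intro measurable_weight) (auto simp: spanning_tree_def)
  qed
  have "{\<omega> \<in> space M. ?Q F \<omega>} \<in> sets M" if F: "F \<in> ?I" for F
  proof -
    have "{\<omega> \<in> space M. ?Q F \<omega>} = {\<omega> \<in> space M. \<forall>F'\<in>?I. \<not> (\<Sum>e\<in>F'. W e \<omega>) < (\<Sum>e\<in>F. W e \<omega>)}"
      using F by (auto simp: min_spanning_tree_def is_arg_min_def)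
    also have "\<dots> \<in> sets M"
    proof (rule sets.sets_Collect_finite_All [OF _ fin])
      fix F' assume "F' \<in> ?I"
      note [measurable] = \<open>F \<in> ?I\<close> \<open>F' \<in> ?I\<close>
      show "{\<omega> \<in> space M. \<not> (\<Sum>e\<in>F'. W e \<omega>) < (\<Sum>e\<in>F. W e \<omega>)} \<in> sets M"
        by measurable
    qed
    finally show ?thesis .
  qed
  then have "{\<omega> \<in> space M. R (THE F. F \<in> {F \<in> ?I. ?Q F \<omega>})} \<in> sets M"
    by (rule sets_Collect_finite_set_of [OF fin])
  moreover have "(THE F. F \<in> {F \<in> ?I. ?Q F \<omega>}) = random_mst h W \<omega>" for \<omega>
    unfolding random_mst_def the_mst_def
    by (rule arg_cong [of _ _ The]) (auto simp: fun_eq_iff min_spanning_tree_def is_arg_min_def)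
  ultimately show ?thesis
    by simp
qed

lemma pattern_set_opposite:
  assumes "\<omega> \<in> lighter_set a b c d \<or> \<omega> \<in> heavier_set a b c d"
  shows "W {a, b} \<omega> < W {c, d} \<omega>"
  using assms by (auto simp: lighter_set_def heavier_set_def pattern_set_def pattern_event_def)

lemma roles_instances: "roles Va Vb Vc Vd" "roles Vc Vd Va Vb"
  by (simp_all add: roles_def)

text \<open>The combinatorial description is valid off the null set of ties, which suffices since
  both events are measurable.\<close>

lemma measure_mst_eq:
  assumes h: "1 \<le> h" and S: "S \<in> sets M"
    and S_iff: "\<And>\<omega>. \<omega> \<in> space M \<Longrightarrow> inj_on (\<lambda>e. W e \<omega>) (G_edges h) \<Longrightarrow> \<omega> \<in> S \<longleftrightarrow> R (random_mst h W \<omega>)"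
  shows "measure M {\<omega> \<in> space M. R (random_mst h W \<omega>)} = measure M S"
proof (rule measure_eq_AE)
  show "AE \<omega> in M. \<omega> \<in> {\<omega> \<in> space M. R (random_mst h W \<omega>)} \<longleftrightarrow> \<omega> \<in> S"
    using AE_distinct_weights AE_space by eventually_elim (simp add: S_iff)
qed (rule sets_mst_event, rule S)

lemma weights_A_B_neq:
  assumes "inj_on (\<lambda>e. W e \<omega>) (G_edges h)"
  shows "W edge_A \<omega> < W edge_B \<omega> \<or> W edge_B \<omega> < W edge_A \<omega>"
proof -
  have "edge_A \<noteq> edge_B"
    by (simp add: edge_A_def edge_B_def doubleton_eq_iff)
  then have "W edge_A \<omega> \<noteq> W edge_B \<omega>"
    using inj_onD [OF assms, of edge_A edge_B] by (auto simp: G_edges_eq)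
  then show ?thesis
    by linarith
qed

text \<open>Edge \<open>A\<close> is either the lighter edge, in the role of \<open>{a, b}\<close>,
  or the heavier one, in the role of \<open>{c, d}\<close> after exchanging the pairs; these events
  are disjoint.\<close>

lemma p_A_eq:
  assumes h: "1 \<le> h"
  shows "p_A h M W = lighter_prob + heavier_prob"
proof -
  let ?L = "lighter_set Va Vb Vc Vd" and ?H = "heavier_set Vc Vd Va Vb"
  have "p_A h M W = measure M (?L \<union> ?H)"
    unfolding p_A_def
  proof (rule measure_mst_eq [OF h])
    fix \<omega> assume \<omega>: "\<omega> \<in> space M" "inj_on (\<lambda>e. W e \<omega>) (G_edges h)"
    show "\<omega> \<in> ?L \<union> ?H \<longleftrightarrow> edge_A \<in> random_mst h W \<omega>"
      unfolding Un_iff lighter_set_iff [OF h roles_instances(1) \<omega>] heavier_set_iff [OF h roles_instances(2) \<omega>]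
      using weights_A_B_neq [OF \<omega>(2)] unfolding edge_A_def edge_B_def by metis
  qed (intro sets.Un sets_lighter_heavier roles_instances)
  also have "\<dots> = measure M ?L + measure M ?H"
    using pattern_set_opposite [of _ Va Vb Vc Vd] pattern_set_opposite [of _ Vc Vd Va Vb]
    by (intro finite_measure_Union sets_lighter_heavier roles_instances) (metis disjoint_iff less_asym)
  finally show ?thesis
    unfolding lighter_set_def heavier_set_def measure_lighter [OF roles_instances(1)]
      measure_heavier [OF roles_instances(2)] .
qed

lemma p_B_eq:
  assumes h: "1 \<le> h"
  shows "p_B h M W = lighter_prob + heavier_prob"
proof -
  let ?L = "lighter_set Vc Vd Va Vb" and ?H = "heavier_set Va Vb Vc Vd"
  have "p_B h M W = measure M (?L \<union> ?H)"
    unfolding p_B_def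
  proof (rule measure_mst_eq [OF h])
    fix \<omega> assume \<omega>: "\<omega> \<in> space M" "inj_on (\<lambda>e. W e \<omega>) (G_edges h)"
    show "\<omega> \<in> ?L \<union> ?H \<longleftrightarrow> edge_B \<in> random_mst h W \<omega>"
      unfolding Un_iff lighter_set_iff [OF h roles_instances(2) \<omega>] heavier_set_iff [OF h roles_instances(1) \<omega>]
      using weights_A_B_neq [OF \<omega>(2)] unfolding edge_A_def edge_B_def by metis
  qed (intro sets.Un sets_lighter_heavier roles_instances)
  also have "\<dots> = measure M ?L + measure M ?H"
    using pattern_set_opposite [of _ Va Vb Vc Vd] pattern_set_opposite [of _ Vc Vd Va Vb]
    by (intro finite_measure_Union sets_lighter_heavier roles_instances) (metis disjoint_iff less_asym)
  finally show ?thesis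
    unfolding lighter_set_def heavier_set_def measure_lighter [OF roles_instances(2)]
      measure_heavier [OF roles_instances(1)] .
qed

lemma p_AB_eq:
  assumes h: "1 \<le> h"
  shows "p_AB h M W = 2 * joint_prob"
proof -
  let ?J = "\<lambda>a b c d. lighter_set a b c d \<inter> heavier_set a b c d"
  have "p_AB h M W = measure M (?J Va Vb Vc Vd \<union> ?J Vc Vd Va Vb)"
    unfolding p_AB_def
  proof (rule measure_mst_eq [OF h])
    fix \<omega> assume \<omega>: "\<omega> \<in> space M" "inj_on (\<lambda>e. W e \<omega>) (G_edges h)"
    show "\<omega> \<in> ?J Va Vb Vc Vd \<union> ?J Vc Vd Va Vb \<longleftrightarrow> edge_A \<in> random_mst h W \<omega> \<and> edge_B \<in> random_mst h W \<omega>"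
      unfolding Un_iff Int_iff lighter_set_iff [OF h roles_instances(1) \<omega>] heavier_set_iff [OF h roles_instances(1) \<omega>]
        lighter_set_iff [OF h roles_instances(2) \<omega>] heavier_set_iff [OF h roles_instances(2) \<omega>]
      using weights_A_B_neq [OF \<omega>(2)] unfolding edge_A_def edge_B_def by metis
  qed (intro sets.Un sets.Int sets_lighter_heavier roles_instances)
  also have "\<dots> = measure M (?J Va Vb Vc Vd) + measure M (?J Vc Vd Va Vb)"
    using pattern_set_opposite [of _ Va Vb Vc Vd] pattern_set_opposite [of _ Vc Vd Va Vb]
    by (intro finite_measure_Union sets.Int sets_lighter_heavier roles_instances) (metis disjoint_iff Int_iff less_asym)
  finally show ?thesis
    unfolding lighter_set_def heavier_set_def measure_joint [OF roles_instances(1)]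
      measure_joint [OF roles_instances(2)] by simp
qed

lemma AE_unique_mst:
  assumes "1 \<le> h"
  shows "AE \<omega> in M. \<exists>!T. min_spanning_tree (G_verts h) (G_edges h) (\<lambda>e. W e \<omega>) T"
  using AE_distinct_weights
proof eventually_elim
  case (elim \<omega>)
  then interpret weighted_graph "G_verts h" "G_edges h" "\<lambda>e. W e \<omega>"
    by (rule weighted_graph_G [OF assms])
  show ?case
    by (rule ex1_mst)
qed

end

section \<open>Evaluation of the integrals\<close>

lemma has_vector_derivative_power_Suc:
  "((\<lambda>v. v ^ Suc m / real (Suc m)) has_vector_derivative v ^ m) (at v within S)"
  unfolding has_real_derivative_iff_has_vector_derivative [symmetric]
  by (auto intro!: derivative_eq_intros simp del: power_Suc of_nat_Suc)

text \<open>Integration by parts: \<open>v ^ Suc m * (1 - v) ^ Suc n\<close> vanishes at both ends,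
  and its derivative relates the integral for exponents \<open>m\<close>, \<open>Suc n\<close> to
  the one for \<open>Suc m\<close>, \<open>n\<close>. Hence the induction on \<open>n\<close> with
  \<open>m\<close> arbitrary.\<close>

lemma has_integral_beta:
  "((\<lambda>v. v ^ m * (1 - v) ^ n) has_integral fact m * fact n / fact (Suc (m + n))) {0..1::real}"
proof (induction n arbitrary: m)
  case 0
  have "((\<lambda>v::real. v ^ m) has_integral 1 ^ Suc m / real (Suc m) - 0 ^ Suc m / real (Suc m)) {0..1}"
    by (rule fundamental_theorem_of_calculus) (simp_all only: zero_le_one has_vector_derivative_power_Suc)
  moreover have "1 ^ Suc m / real (Suc m) - 0 ^ Suc m / real (Suc m) = (fact m * fact 0 / fact (Suc (m + 0)) :: real)"
    by (simp del: of_nat_Suc)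
  ultimately show ?case
    by simp
next
  case (Suc n)
  let ?f = "\<lambda>v::real. real (Suc m) * (v ^ m * (1 - v) ^ Suc n) - real (Suc n) * (v ^ Suc m * (1 - v) ^ n)"
  have "((\<lambda>v. v ^ Suc m * (1 - v) ^ Suc n) has_vector_derivative ?f v) (at v within {0..1})" for v
    unfolding has_real_derivative_iff_has_vector_derivative [symmetric]
    by (auto intro!: derivative_eq_intros simp: mult_ac simp del: power_Suc of_nat_Suc)
  then have "(?f has_integral 1 ^ Suc m * (1 - 1) ^ Suc n - 0 ^ Suc m * (1 - 0) ^ Suc n) {0..1}"
    by (intro fundamental_theorem_of_calculus) simp_all
  then have "((\<lambda>v. ?f v + real (Suc n) * (v ^ Suc m * (1 - v) ^ n)) has_integral
      0 + real (Suc n) * (fact (Suc m) * fact n / fact (Suc (Suc m + n)))) {0..1}"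
    by (intro has_integral_add has_integral_mult_right Suc.IH) simp
  then have "((\<lambda>v. inverse (real (Suc m)) * (real (Suc m) * (v ^ m * (1 - v) ^ Suc n))) has_integral
      inverse (real (Suc m)) * (real (Suc n) * (fact (Suc m) * fact n / fact (Suc (Suc m + n))))) {0..1}"
    by (intro has_integral_mult_right) simp
  moreover have "inverse (real (Suc m)) * (real (Suc n) * (fact (Suc m) * fact n / fact (Suc (Suc m + n)))) =
      (fact m * fact (Suc n) / fact (Suc (m + Suc n)) :: real)"
    by (simp del: of_nat_Suc add: fact_Suc [of m] fact_Suc [of n])
  moreover have "inverse (real (Suc m)) * (real (Suc m) * t) = t" for t :: real
    by (simp add: mult.assoc [symmetric] del: of_nat_Suc)
  ultimately show ?case
    by (simp only:)
qed

lemma lborel_integral_Ioo: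
  fixes f :: "real \<Rightarrow> real"
  assumes "continuous_on {0..b} f" "(f has_integral I) {0..b}"
  shows "(\<integral>x. indicator {0<..<b} x * f x \<partial>lborel) = I"
proof -
  have "set_integrable lborel {0<..<b} f"
    by (rule set_integrable_subset [OF borel_integrable_atLeastAtMost' [OF assms(1)]]) auto
  then have "(LINT x:{0<..<b}|lborel. f x) = integral {0<..<b} f"
    by (rule set_borel_integral_eq_integral)
  also have "\<dots> = I"
    using assms(2) by (simp add: has_integral_Icc_iff_Ioo integral_unique)
  finally show ?thesis
    by (simp add: set_lebesgue_integral_def)
qed

lemma unit_interval_integral:
  "(\<integral>x. f x \<partial>unit_interval) = (\<integral>x. indicator {0<..<1} x * (f x :: real) \<partial>lborel)"
  by (subst integral_restrict_space) simp_all

text \<open>Integrating \<open>u ^ a\<close> over \<open>0 < u < v\<close> gives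
  \<open>v ^ (a + 1) / (a + 1)\<close>; what remains is the beta integral with exponents
  \<open>a + b + 1\<close> and \<open>c\<close>.\<close>

definition monomial_integral :: "nat \<Rightarrow> nat \<Rightarrow> nat \<Rightarrow> real" where
  "monomial_integral a b c = fact (a + b + 1) * fact c / (real (a + 1) * fact (a + b + c + 2))"

lemma continuous2_monomial: "continuous2 (\<lambda>u v. u ^ a * v ^ b * (1 - v) ^ c)"
  unfolding continuous2_def by (intro continuous_intros)

lemma triangle_integral_monomial:
  "triangle_integral (\<lambda>u v. u ^ a * v ^ b * (1 - v) ^ c) = monomial_integral a b c"
proof -
  interpret U: prob_space unit_interval
    by (rule prob_space_unit_interval)
  interpret P: pair_sigma_finite unit_interval unit_interval ..
  let ?g = "\<lambda>u v::real. if u < v then u ^ a * v ^ b * (1 - v) ^ c else 0"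
  have inner: "(\<integral>u. ?g u v \<partial>unit_interval) = v ^ Suc (a + b) * (1 - v) ^ c / real (Suc a)"
    if v: "0 < v" "v < 1" for v
  proof -
    have "((\<lambda>u::real. u ^ a) has_integral v ^ Suc a / real (Suc a) - 0 ^ Suc a / real (Suc a)) {0..v}"
      using v by (intro fundamental_theorem_of_calculus has_vector_derivative_power_Suc) simp
    then have I: "((\<lambda>u. u ^ a * (v ^ b * (1 - v) ^ c)) has_integral
        v ^ Suc a / real (Suc a) * (v ^ b * (1 - v) ^ c)) {0..v}"
      by (intro has_integral_mult_left) simp
    have "(\<integral>u. ?g u v \<partial>unit_interval) =
        (\<integral>u. indicator {0<..<v} u * (u ^ a * (v ^ b * (1 - v) ^ c)) \<partial>lborel)"
      unfolding unit_interval_integral using v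
      by (intro Bochner_Integration.integral_cong) (auto simp: indicator_def)
    also have "\<dots> = v ^ Suc a / real (Suc a) * (v ^ b * (1 - v) ^ c)"
      by (rule lborel_integral_Ioo [OF _ I]) (intro continuous_intros)
    finally show ?thesis
      by (simp add: power_add mult_ac)
  qed
  have "triangle_integral (\<lambda>u v. u ^ a * v ^ b * (1 - v) ^ c) = (\<integral>v. \<integral>u. ?g u v \<partial>unit_interval \<partial>unit_interval)"
    unfolding triangle_integral_def
    using P.integral_snd [of ?g] triangle_integrable [OF continuous2_monomial, of a b c]
    by (simp add: case_prod_unfold)
  also have "\<dots> = (\<integral>v. v ^ Suc (a + b) * (1 - v) ^ c / real (Suc a) \<partial>unit_interval)"
    by (intro Bochner_Integration.integral_cong refl inner) (auto simp: space_restrict_space)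
  also have "\<dots> = (\<integral>v. indicator {0<..<1} v * (v ^ Suc (a + b) * (1 - v) ^ c / real (Suc a)) \<partial>lborel)"
    by (rule unit_interval_integral)
  also have "\<dots> = fact (Suc (a + b)) * fact c / fact (Suc (Suc (a + b) + c)) / real (Suc a)"
    by (intro lborel_integral_Ioo has_integral_divide has_integral_beta continuous_intros) simp
  finally show ?thesis
    by (simp add: monomial_integral_def)
qed

text \<open>\<open>i\<close>, \<open>j\<close>, \<open>k\<close> count the factors from which the
  terms with coefficients \<open>x\<close>, \<open>y\<close>, \<open>z\<close> are chosen; the
  constant 1 is taken from the rest.\<close>

definition expanded_integral ::
    "nat \<Rightarrow> nat \<Rightarrow> real \<Rightarrow> real \<Rightarrow> real \<Rightarrow> nat \<Rightarrow> nat \<Rightarrow> nat \<Rightarrow> real" where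
  "expanded_integral h e x y z p q r = (\<Sum>i\<le>h. \<Sum>j\<le>h - i. \<Sum>k\<le>h - i - j.
     real (h choose i) * real (h - i choose j) * real (h - i - j choose k) * x ^ i * y ^ j * z ^ k *
     monomial_integral (2 * i + 3 * j + p * k) (q * k) (e * h + r * k))"

lemma triangle_integral_expand:
  "triangle_integral (\<lambda>u v. ((1 - v) ^ e * (1 + x * u^2 + y * u^3 + z * u^p * v^q * (1 - v)^r)) ^ h) =
    expanded_integral h e x y z p q r"
proof -
  let ?I = "SIGMA i:{..h}. SIGMA j:{..h - i}. {..h - i - j}"
  let ?c = "\<lambda>(i, j, k). real (h choose i) * real (h - i choose j) * real (h - i - j choose k) * x ^ i * y ^ j * z ^ k"
  let ?m = "\<lambda>(i, j, k) u v. u ^ (2 * i + 3 * j + p * k) * v ^ (q * k) * (1 - v) ^ (e * h + r * k)"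
  have "((1 - v) ^ e * (1 + x * u^2 + y * u^3 + z * u^p * v^q * (1 - v)^r)) ^ h = (\<Sum>t\<in>?I. ?c t * ?m t u v)" for u v
  proof -
    \<comment> \<open>The nesting with 1 innermost lets the binomial theorem be applied three
      times.\<close>
    have "(x * u^2 + (y * u^3 + (z * u^p * v^q * (1 - v)^r + 1))) ^ h =
      (\<Sum>i\<le>h. \<Sum>j\<le>h - i. \<Sum>k\<le>h - i - j. real (h choose i) * (x * u^2) ^ i * (real (h - i choose j) * (y * u^3) ^ j *
        (real (h - i - j choose k) * (z * u^p * v^q * (1 - v)^r) ^ k)))"
      by (simp add: binomial_ring sum_distrib_left mult.assoc)
    then have "((1 - v) ^ e * (1 + x * u^2 + y * u^3 + z * u^p * v^q * (1 - v)^r)) ^ h =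
      (\<Sum>i\<le>h. \<Sum>j\<le>h - i. \<Sum>k\<le>h - i - j. (1 - v) ^ (e * h) * (real (h choose i) * (x * u^2) ^ i * (real (h - i choose j) * (y * u^3) ^ j *
        (real (h - i - j choose k) * (z * u^p * v^q * (1 - v)^r) ^ k))))"
      by (simp add: power_mult_distrib power_mult sum_distrib_left add_ac)
    also have "\<dots> = (\<Sum>i\<le>h. \<Sum>j\<le>h - i. \<Sum>k\<le>h - i - j. ?c (i, j, k) * ?m (i, j, k) u v)"
      by (intro sum.cong refl) (simp add: power_mult_distrib power_mult [symmetric] power_add mult_ac)
    also have "\<dots> = (\<Sum>t\<in>?I. ?c t * ?m t u v)"
      by (simp add: sum.Sigma case_prod_unfold)
    finally show ?thesis .
  qed
  then have "triangle_integral (\<lambda>u v. ((1 - v) ^ e * (1 + x * u^2 + y * u^3 + z * u^p * v^q * (1 - v)^r)) ^ h) =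
      triangle_integral (\<lambda>u v. \<Sum>t\<in>?I. ?c t * ?m t u v)"
    by (simp only:)
  also have "\<dots> = (\<Sum>t\<in>?I. ?c t * triangle_integral (?m t))"
    by (rule triangle_integral_sum) (auto intro: continuous2_monomial)
  also have "\<dots> = expanded_integral h e x y z p q r"
    by (simp add: expanded_integral_def sum.Sigma case_prod_unfold triangle_integral_monomial)
  finally show ?thesis .
qed

section \<open>Exact rational values for \<open>h\<close> from 1 to 9\<close>

lemma sum_atMost_numeral: "(\<Sum>i\<le>numeral k. f i) = (\<Sum>i\<le>pred_numeral k. f i) + f (numeral k)" for f :: "nat \<Rightarrow> real"
  unfolding numeral_eq_Suc by simp

lemma sum_atMost_one: "(\<Sum>i\<le>1. f i) = f 0 + f 1" "(\<Sum>i\<le>Suc 0. f i) = f 0 + f 1" for f :: "nat \<Rightarrow> real"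
  by simp_all

text \<open>The three binomials telescope to a multinomial coefficient; with tabulated factorials
  the evaluation becomes plain rational arithmetic.\<close>

lemma expanded_integral_fact:
  "expanded_integral h e x y z p q r = fact h * (\<Sum>i\<le>h. x ^ i / fact i * (\<Sum>j\<le>h - i. y ^ j / fact j * (\<Sum>k\<le>h - i - j.
     z ^ k / (fact k * fact (h - i - j - k)) *
     monomial_integral (2 * i + 3 * j + p * k) (q * k) (e * h + r * k))))"
  unfolding expanded_integral_def sum_distrib_left
  by (intro sum.cong refl) (simp add: binomial_fact field_simps)

text \<open>The four polynomials of the lighter edge do not contain \<open>v\<close>, so this case
  spares them all large factorials.\<close>

lemma monomial_integral_0: "monomial_integral a 0 0 = 1 / (real (a + 1) * real (a + 2))"
  by (simp add: monomial_integral_def field_simps del: of_nat_Suc of_nat_add)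

lemma fact_values:
  "fact 2 = (2 :: real)"
  "fact 3 = (6 :: real)"
  "fact 4 = (24 :: real)"
  "fact 5 = (120 :: real)"
  "fact 6 = (720 :: real)"
  "fact 7 = (5040 :: real)"
  "fact 8 = (40320 :: real)"
  "fact 9 = (362880 :: real)"
  "fact 10 = (3628800 :: real)"
  "fact 11 = (39916800 :: real)"
  "fact 12 = (479001600 :: real)"
  "fact 13 = (6227020800 :: real)"
  "fact 14 = (87178291200 :: real)"
  "fact 15 = (1307674368000 :: real)"
  "fact 16 = (20922789888000 :: real)"
  "fact 17 = (355687428096000 :: real)"
  "fact 18 = (6402373705728000 :: real)"
  "fact 19 = (121645100408832000 :: real)"
  "fact 20 = (2432902008176640000 :: real)"
  "fact 21 = (51090942171709440000 :: real)"
  "fact 22 = (1124000727777607680000 :: real)"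
  "fact 23 = (25852016738884976640000 :: real)"
  "fact 24 = (620448401733239439360000 :: real)"
  "fact 25 = (15511210043330985984000000 :: real)"
  "fact 26 = (403291461126605635584000000 :: real)"
  "fact 27 = (10888869450418352160768000000 :: real)"
  "fact 28 = (304888344611713860501504000000 :: real)"
  "fact 29 = (8841761993739701954543616000000 :: real)"
  "fact 30 = (265252859812191058636308480000000 :: real)"
  "fact 31 = (8222838654177922817725562880000000 :: real)"
  "fact 32 = (263130836933693530167218012160000000 :: real)"
  "fact 33 = (8683317618811886495518194401280000000 :: real)"
  "fact 34 = (295232799039604140847618609643520000000 :: real)"
  "fact 35 = (10333147966386144929666651337523200000000 :: real)"
  "fact 36 = (371993326789901217467999448150835200000000 :: real)"
  "fact 37 = (13763753091226345046315979581580902400000000 :: real)"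
  "fact 38 = (523022617466601111760007224100074291200000000 :: real)"
  "fact 39 = (20397882081197443358640281739902897356800000000 :: real)"
  "fact 40 = (815915283247897734345611269596115894272000000000 :: real)"
  "fact 41 = (33452526613163807108170062053440751665152000000000 :: real)"
  "fact 42 = (1405006117752879898543142606244511569936384000000000 :: real)"
  "fact 43 = (60415263063373835637355132068513997507264512000000000 :: real)"
  "fact 44 = (2658271574788448768043625811014615890319638528000000000 :: real)"
  "fact 45 = (119622220865480194561963161495657715064383733760000000000 :: real)"
  "fact 46 = (5502622159812088949850305428800254892961651752960000000000 :: real)"
  "fact 47 = (258623241511168180642964355153611979969197632389120000000000 :: real)"
  "fact 48 = (12413915592536072670862289047373375038521486354677760000000000 :: real)"
  "fact 49 = (608281864034267560872252163321295376887552831379210240000000000 :: real)"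
  by (simp_all add: fact_numeral)

lemma expanded_integral_13:
  "expanded_integral 1 0 (- 3) 3 (- 1) 4 0 0 = 11 / 30"
  "expanded_integral 2 0 (- 3) 3 (- 1) 4 0 0 = 757 / 2520"
  "expanded_integral 3 0 (- 3) 3 (- 1) 4 0 0 = 31217 / 120120"
  "expanded_integral 4 0 (- 3) 3 (- 1) 4 0 0 = 1421683 / 6126120"
  "expanded_integral 5 0 (- 3) 3 (- 1) 4 0 0 = 547139 / 2586584"
  "expanded_integral 6 0 (- 3) 3 (- 1) 4 0 0 = 158668663 / 811246800"
  "expanded_integral 7 0 (- 3) 3 (- 1) 4 0 0 = 20269362757 / 110909026800"
  "expanded_integral 8 0 (- 3) 3 (- 1) 4 0 0 = 8967842441 / 52093633800"
  "expanded_integral 9 0 (- 3) 3 (- 1) 4 0 0 = 91741301632 / 562177131425"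
  by (simp_all add: expanded_integral_fact monomial_integral_0 sum_atMost_numeral sum_atMost_one fact_values
    del: fact_numeral)

text \<open>With \<open>z = 1 - (1 - u)^2\<close> the integral is half of the integral of
  \<open>(1 - z^2)^h\<close> over the unit interval, which explains the simple values
  \<open>(2 * 4 * ... * (2 * h)) / (2 * (3 * 5 * ... * (2 * h + 1)))\<close>.\<close>

lemma expanded_integral_22:
  "expanded_integral 1 0 (- 4) 4 (- 1) 4 0 0 = 1 / 3"
  "expanded_integral 2 0 (- 4) 4 (- 1) 4 0 0 = 4 / 15"
  "expanded_integral 3 0 (- 4) 4 (- 1) 4 0 0 = 8 / 35"
  "expanded_integral 4 0 (- 4) 4 (- 1) 4 0 0 = 64 / 315"
  "expanded_integral 5 0 (- 4) 4 (- 1) 4 0 0 = 128 / 693"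
  "expanded_integral 6 0 (- 4) 4 (- 1) 4 0 0 = 512 / 3003"
  "expanded_integral 7 0 (- 4) 4 (- 1) 4 0 0 = 1024 / 6435"
  "expanded_integral 8 0 (- 4) 4 (- 1) 4 0 0 = 16384 / 109395"
  "expanded_integral 9 0 (- 4) 4 (- 1) 4 0 0 = 32768 / 230945"
  by (simp_all add: expanded_integral_fact monomial_integral_0 sum_atMost_numeral sum_atMost_one fact_values
    del: fact_numeral)

lemma expanded_integral_211:
  "expanded_integral 1 0 (- 5) 6 (- 2) 4 0 0 = 19 / 60"
  "expanded_integral 2 0 (- 5) 6 (- 2) 4 0 0 = 157 / 630"
  "expanded_integral 3 0 (- 5) 6 (- 2) 4 0 0 = 25447 / 120120"
  "expanded_integral 4 0 (- 5) 6 (- 2) 4 0 0 = 40991 / 218790"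
  "expanded_integral 5 0 (- 5) 6 (- 2) 4 0 0 = 11553 / 68068"
  "expanded_integral 6 0 (- 5) 6 (- 2) 4 0 0 = 8300579 / 53117350"
  "expanded_integral 7 0 (- 5) 6 (- 2) 4 0 0 = 48431992573 / 332727080400"
  "expanded_integral 8 0 (- 5) 6 (- 2) 4 0 0 = 176352767339 / 1289317436550"
  "expanded_integral 9 0 (- 5) 6 (- 2) 4 0 0 = 9603247280321 / 74207381348100"
  by (simp_all add: expanded_integral_fact monomial_integral_0 sum_atMost_numeral sum_atMost_one fact_values
    del: fact_numeral)

lemma expanded_integral_1111:
  "expanded_integral 1 0 (- 6) 8 (- 3) 4 0 0 = 3 / 10"
  "expanded_integral 2 0 (- 6) 8 (- 3) 4 0 0 = 7 / 30"
  "expanded_integral 3 0 (- 6) 8 (- 3) 4 0 0 = 395 / 2002"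
  "expanded_integral 4 0 (- 6) 8 (- 3) 4 0 0 = 207 / 1190"
  "expanded_integral 5 0 (- 6) 8 (- 3) 4 0 0 = 23467 / 149226"
  "expanded_integral 6 0 (- 6) 8 (- 3) 4 0 0 = 166423 / 1151150"
  "expanded_integral 7 0 (- 6) 8 (- 3) 4 0 0 = 58317 / 433550"
  "expanded_integral 8 0 (- 6) 8 (- 3) 4 0 0 = 4967713 / 39338442"
  "expanded_integral 9 0 (- 6) 8 (- 3) 4 0 0 = 28219673 / 236366878"
  by (simp_all add: expanded_integral_fact monomial_integral_0 sum_atMost_numeral sum_atMost_one fact_values
    del: fact_numeral)

lemma expanded_integral_heavier:
  "expanded_integral 1 1 0 0 1 0 1 2 = 11 / 60"
  "expanded_integral 2 1 0 0 1 0 1 2 = 29 / 280"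
  "expanded_integral 3 1 0 0 1 0 1 2 = 703 / 10010"
  "expanded_integral 4 1 0 0 1 0 1 2 = 5849 / 111384"
  "expanded_integral 5 1 0 0 1 0 1 2 = 1940761 / 46558512"
  "expanded_integral 6 1 0 0 1 0 1 2 = 307324679 / 8923714800"
  "expanded_integral 7 1 0 0 1 0 1 2 = 3246824689 / 110909026800"
  "expanded_integral 8 1 0 0 1 0 1 2 = 3972448331 / 156280901400"
  "expanded_integral 9 1 0 0 1 0 1 2 = 2219865240007 / 98943175130800"
  by (simp_all add: expanded_integral_fact monomial_integral_def sum_atMost_numeral sum_atMost_one fact_values
    del: fact_numeral)

lemma expanded_integral_heavier_both:
  "expanded_integral 1 2 0 0 2 0 1 1 = 7 / 60"
  "expanded_integral 2 2 0 0 2 0 1 1 = 13 / 210"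
  "expanded_integral 3 2 0 0 2 0 1 1 = 1657 / 40040"
  "expanded_integral 4 2 0 0 2 0 1 1 = 9445 / 306306"
  "expanded_integral 5 2 0 0 2 0 1 1 = 94925 / 3879876"
  "expanded_integral 6 2 0 0 2 0 1 1 = 3759817 / 185910725"
  "expanded_integral 7 2 0 0 2 0 1 1 = 127211917 / 7393935120"
  "expanded_integral 8 2 0 0 2 0 1 1 = 6425803369 / 429772478850"
  "expanded_integral 9 2 0 0 2 0 1 1 = 326714468063 / 24735793782700"
  by (simp_all add: expanded_integral_fact monomial_integral_def sum_atMost_numeral sum_atMost_one fact_values
    del: fact_numeral)

lemma expanded_integral_joint:
  "expanded_integral 1 1 (- 2) 1 1 0 1 2 = 19 / 120"
  "expanded_integral 2 1 (- 2) 1 1 0 1 2 = 73 / 840"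
  "expanded_integral 3 1 (- 2) 1 1 0 1 2 = 98341 / 1681680"
  "expanded_integral 4 1 (- 2) 1 1 0 1 2 = 1439107 / 32986800"
  "expanded_integral 5 1 (- 2) 1 1 0 1 2 = 507619243 / 14665931280"
  "expanded_integral 6 1 (- 2) 1 1 0 1 2 = 114952632499 / 4019687331660"
  "expanded_integral 7 1 (- 2) 1 1 0 1 2 = 64787607609349 / 2664478459843200"
  "expanded_integral 8 1 (- 2) 1 1 0 1 2 = 7850013971280367 / 371694745148126400"
  "expanded_integral 9 1 (- 2) 1 1 0 1 2 = 92038659198354536441 / 4935693221405842896000"
  by (simp_all add: expanded_integral_fact monomial_integral_def sum_atMost_numeral sum_atMost_one fact_values
    del: fact_numeral)

lemma expanded_integral_joint_same:
  "expanded_integral 1 1 (- 3) 2 1 0 1 2 = 3 / 20"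
  "expanded_integral 2 1 (- 3) 2 1 0 1 2 = 103 / 1260"
  "expanded_integral 3 1 (- 3) 2 1 0 1 2 = 18463 / 336336"
  "expanded_integral 4 1 (- 3) 2 1 0 1 2 = 233965 / 5717712"
  "expanded_integral 5 1 (- 3) 2 1 0 1 2 = 2033831 / 62674920"
  "expanded_integral 6 1 (- 3) 2 1 0 1 2 = 14084572091 / 525449324400"
  "expanded_integral 7 1 (- 3) 2 1 0 1 2 = 131421958621 / 5767269393600"
  "expanded_integral 8 1 (- 3) 2 1 0 1 2 = 68111083987117 / 3441618010630800"
  "expanded_integral 9 1 (- 3) 2 1 0 1 2 = 24569729468440641 / 1406180404958929600"
  by (simp_all add: expanded_integral_fact monomial_integral_def sum_atMost_numeral sum_atMost_one fact_values
    del: fact_numeral)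

lemma expanded_integral_joint_cross:
  "expanded_integral 1 2 (- 1) 0 2 0 1 1 = 1 / 9"
  "expanded_integral 2 2 (- 1) 0 2 0 1 1 = 277 / 4725"
  "expanded_integral 3 2 (- 1) 0 2 0 1 1 = 4111 / 105105"
  "expanded_integral 4 2 (- 1) 0 2 0 1 1 = 1003253 / 34459425"
  "expanded_integral 5 2 (- 1) 0 2 0 1 1 = 77590651 / 3360942585"
  "expanded_integral 6 2 (- 1) 0 2 0 1 1 = 322707263 / 16917875975"
  "expanded_integral 7 2 (- 1) 0 2 0 1 1 = 21253287509 / 1310112879075"
  "expanded_integral 8 2 (- 1) 0 2 0 1 1 = 107043932571187 / 7594724359997775"
  "expanded_integral 9 2 (- 1) 0 2 0 1 1 = 724011680461541 / 58160035131573375"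
  by (simp_all add: expanded_integral_fact monomial_integral_def sum_atMost_numeral sum_atMost_one fact_values
    del: fact_numeral)

definition single_value :: "nat \<Rightarrow> real" where
  "single_value h = 2 * expanded_integral h 0 (- 3) 3 (- 1) 4 0 0 + 2 * expanded_integral h 0 (- 4) 4 (- 1) 4 0 0
    - 5 * expanded_integral h 0 (- 5) 6 (- 2) 4 0 0 + 2 * expanded_integral h 0 (- 6) 8 (- 3) 4 0 0
    + 2 * expanded_integral h 1 0 0 1 0 1 2 - expanded_integral h 2 0 0 2 0 1 1"

definition joint_value :: "nat \<Rightarrow> real" where
  "joint_value h = 2 * (4 * expanded_integral h 1 (- 2) 1 1 0 1 2 - 2 * expanded_integral h 1 (- 3) 2 1 0 1 2
    - expanded_integral h 2 (- 1) 0 2 0 1 1)"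

text \<open>A check at \<open>h = 1\<close>: the graph is two triangles sharing a vertex, and an
  edge is in the tree unless it is the heaviest of its triangle, whence 2/3 here and the product 4/9
  for the joint value.\<close>

lemma single_value_eq:
  "single_value 1 = 2 / 3"
  "single_value 2 = 1 / 2"
  "single_value 3 = 1123 / 2730"
  "single_value 4 = 544933 / 1531530"
  "single_value 5 = 568103 / 1790712"
  "single_value 6 = 10731429 / 37182145"
  "single_value 7 = 2606373997 / 9786090600"
  "single_value 8 = 320245982159 / 1289317436550"
  "single_value 9 = 4951519969327 / 21202108956600"
  unfolding single_value_def expanded_integral_13 expanded_integral_22 expanded_integral_211
    expanded_integral_1111 expanded_integral_heavier expanded_integral_heavier_both by simp_all

lemma joint_value_eq:
  "joint_value 1 = 4 / 9"
  "joint_value 2 = 1186 / 4725"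
  "joint_value 3 = 71479 / 420420"
  "joint_value 4 = 24528499 / 192972780"
  "joint_value 5 = 1017591682 / 10082827755"
  "joint_value 6 = 1676413313149 / 20098436658300"
  "joint_value 7 = 106303586434949 / 1498769133661800"
  "joint_value 8 = 2561006549304523 / 41571122812619400"
  "joint_value 9 = 197400895109230339 / 3629186192210178600"
  unfolding joint_value_def expanded_integral_joint expanded_integral_joint_same
    expanded_integral_joint_cross by simp_all

text \<open>The bound is the ratio at \<open>h = 3\<close>, namely 71479/420420 divided by the
  square of 1123/2730.\<close>

lemma ratio_le_at_3:
  assumes "h \<in> {1..9}"
  shows "joint_value h / (single_value h * single_value h) \<le> 13938405 / 13872419"
proof -
  have "h = 1 \<or> h = 2 \<or> h = 3 \<or> h = 4 \<or> h = 5 \<or> h = 6 \<or> h = 7 \<or> h = 8 \<or> h = 9"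
    using assms unfolding atLeastAtMost_iff by presburger
  then show ?thesis
    by (elim disjE) (simp_all only: joint_value_eq single_value_eq, simp_all)
qed

context hub_weights
begin

lemma power_integral_expand:
  assumes "\<And>u v. f u v = (1 - v) ^ e * (1 + x * u^2 + y * u^3 + z * u^p * v^q * (1 - v)^r)"
  shows "power_integral f = expanded_integral h e x y z p q r"
  unfolding assms by (rule triangle_integral_expand)

lemma single_value_integrals: "lighter_prob + heavier_prob = single_value h"
proof -
  have "power_integral (\<lambda>u v. 1 - 3 * u^2 + 3 * u^3 - u^4) = expanded_integral h 0 (- 3) 3 (- 1) 4 0 0"
    "power_integral (\<lambda>u v. 1 - 4 * u^2 + 4 * u^3 - u^4) = expanded_integral h 0 (- 4) 4 (- 1) 4 0 0"
    "power_integral (\<lambda>u v. 1 - 5 * u^2 + 6 * u^3 - 2 * u^4) = expanded_integral h 0 (- 5) 6 (- 2) 4 0 0"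
    "power_integral (\<lambda>u v. 1 - 6 * u^2 + 8 * u^3 - 3 * u^4) = expanded_integral h 0 (- 6) 8 (- 3) 4 0 0"
    "power_integral (\<lambda>u v. (1 - v) * (1 + v * (1 - v)^2)) = expanded_integral h 1 0 0 1 0 1 2"
    "power_integral (\<lambda>u v. (1 - v)^2 * (1 + 2 * v * (1 - v))) = expanded_integral h 2 0 0 2 0 1 1"
    by (rule power_integral_expand, simp)+
  then show ?thesis
    by (simp add: lighter_prob_def heavier_prob_def single_value_def)
qed

lemma joint_value_integrals: "2 * joint_prob = joint_value h"
proof -
  have "power_integral (\<lambda>u v. (1 - v) * (1 - 2 * u^2 + u^3 + v * (1 - v)^2)) = expanded_integral h 1 (- 2) 1 1 0 1 2"
    "power_integral (\<lambda>u v. (1 - v) * (1 - 3 * u^2 + 2 * u^3 + v * (1 - v)^2)) = expanded_integral h 1 (- 3) 2 1 0 1 2"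
    "power_integral (\<lambda>u v. (1 - v)^2 * (1 - u^2 + 2 * v * (1 - v))) = expanded_integral h 2 (- 1) 0 2 0 1 1"
    by (rule power_integral_expand, simp)+
  then show ?thesis
    by (simp add: joint_prob_def joint_value_def)
qed

end

text \<open>Each \<open>h\<close> has its own probability space, weights and law. The ratios can
  still be compared across \<open>h\<close>, because each one equals a number determined by
  \<open>h\<close> alone.\<close>

theorem proposition4p4:
  fixes M :: "nat \<Rightarrow> 'w measure"
    and W :: "nat \<Rightarrow> vertex set \<Rightarrow> 'w \<Rightarrow> real"
    and law :: "nat \<Rightarrow> real measure"
  assumes weights: "\<And>h. 1 \<le> h \<Longrightarrow> iid_atomless_weights (M h) (G_edges h) (W h) (law h)"
  shows "(\<forall>h\<ge>1. AE \<omega> in M h. \<exists>!T. min_spanning_tree (G_verts h) (G_edges h) (\<lambda>e. W h e \<omega>) T)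
    \<and> (p_A 2 (M 2) (W 2) = 1 / 2 \<and> p_B 2 (M 2) (W 2) = 1 / 2
        \<and> p_AB 2 (M 2) (W 2) = 1186 / 4725
        \<and> mst_ratio 2 (M 2) (W 2) = 4744 / 4725)
    \<and> (p_A 3 (M 3) (W 3) = 1123 / 2730 \<and> p_B 3 (M 3) (W 3) = 1123 / 2730
        \<and> p_AB 3 (M 3) (W 3) = 71479 / 420420
        \<and> mst_ratio 3 (M 3) (W 3) = 13938405 / 13872419
        \<and> 1.004756 \<le> mst_ratio 3 (M 3) (W 3) \<and> mst_ratio 3 (M 3) (W 3) < 1.004757
        \<and> mst_ratio 3 (M 3) (W 3) > 78100 / 77841)
    \<and> (\<forall>h\<in>{1..9}. mst_ratio h (M h) (W h) \<le> mst_ratio 3 (M 3) (W 3))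
    \<and> (\<forall>h\<in>{7, 8, 9}. mst_ratio h (M h) (W h) < 1)"
proof -
  have hub: "hub_weights (M h) h (W h) (law h)" if "1 \<le> h" for h
    using weights [OF that] by (simp add: hub_weights_def)
  have A: "p_A h (M h) (W h) = single_value h" and B: "p_B h (M h) (W h) = single_value h"
    and AB: "p_AB h (M h) (W h) = joint_value h" if "1 \<le> h" for h
    using hub_weights.p_A_eq [OF hub [OF that] that] hub_weights.p_B_eq [OF hub [OF that] that]
      hub_weights.p_AB_eq [OF hub [OF that] that] hub_weights.single_value_integrals [OF hub [OF that]]
      hub_weights.joint_value_integrals [OF hub [OF that]] by simp_all
  have ratio: "mst_ratio h (M h) (W h) = joint_value h / (single_value h * single_value h)" if "1 \<le> h" for h
    using A [OF that] B [OF that] AB [OF that] by (simp add: mst_ratio_def)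
  have ratio3: "mst_ratio 3 (M 3) (W 3) = 13938405 / 13872419"
    by (simp add: ratio joint_value_eq single_value_eq)
  have "mst_ratio h (M h) (W h) \<le> mst_ratio 3 (M 3) (W 3)" if "h \<in> {1..9}" for h
    using that ratio_le_at_3 [of h] unfolding ratio3 by (simp add: ratio)
  moreover have "mst_ratio h (M h) (W h) < 1" if "h \<in> {7, 8, 9}" for h
    using that by (auto simp: ratio joint_value_eq single_value_eq)
  moreover have "AE \<omega> in M h. \<exists>!T. min_spanning_tree (G_verts h) (G_edges h) (\<lambda>e. W h e \<omega>) T"
    if "1 \<le> h" for h
    by (rule hub_weights.AE_unique_mst [OF hub [OF that] that])
  moreover have "p_A 2 (M 2) (W 2) = 1 / 2 \<and> p_B 2 (M 2) (W 2) = 1 / 2 \<and> p_AB 2 (M 2) (W 2) = 1186 / 4725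
      \<and> mst_ratio 2 (M 2) (W 2) = 4744 / 4725"
    by (simp add: A B AB ratio joint_value_eq single_value_eq)
  moreover have "p_A 3 (M 3) (W 3) = 1123 / 2730 \<and> p_B 3 (M 3) (W 3) = 1123 / 2730
      \<and> p_AB 3 (M 3) (W 3) = 71479 / 420420"
    by (simp add: A B AB joint_value_eq single_value_eq)
  moreover have "1.004756 \<le> mst_ratio 3 (M 3) (W 3) \<and> mst_ratio 3 (M 3) (W 3) < 1.004757
      \<and> mst_ratio 3 (M 3) (W 3) > 78100 / 77841"
    by (simp add: ratio3)
  ultimately show ?thesis
    using ratio3 by blast
qed

end
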